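(* Let $(X,d,\mu)$ be a quasi-metric-measure space. Let $\nu$ be a measure (on the same $\sigma$-algebra as $\mu$) such that $\nu\le C\mu$ for some constant $C\in(0,\infty)$. Assume $\rho$ is a symmetric quasi-metric on $X$ which is equivalent to $d$ and continuous on $X\times X$. Suppose that there exist $r_0\in(0,\infty)$ and $x_0\in X$ such that for all $r\in(0,r_0]$ the following conditions are satisfied: (i) the family $\left\{\dfrac{\chi_{B_\rho(y,r)}(\cdot)}{\mu(B_\rho(\cdot,r))}\right\}_{y\in X}$ is equi-integrable with respect to the measure $\nu$, and (ii) $\displaystyle\sup_{y\in X\setminus B_\rho(x_0,R)}\int_{B_\rho(y,r)}\frac{1}{\mu(B_\rho(x,r))}\,d\nu(x)\to0$ as $R\to\infty$. Then for any $\alpha,p\in(0,\infty)$ and $q\in(0,\infty]$, the embeddings $$M^\alpha_{p,q}(X,d,\mu)\hookrightarrow L^p(X,\nu)\quad\text{and}\quad N^\alpha_{p,q}(X,d,\mu)\hookrightarrow L^p(X,\nu)$$ are compact.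
   Context: A quasi-metric space $(X,d)$ is a set $X$ with at least two elements and a function $d:X\times X\to[0,\infty)$ for which there are constants $C_0,C_1\in(0,\infty)$ such that for all $x,y,z\in X$: $d(x,y)=0$ iff $x=y$; $d(y,x)\le C_0 d(x,y)$; $d(x,y)\le C_1\max\{d(x,z),d(z,y)\}$ (symmetry is not required). Balls are $B_d(x,r):=\{y\in X:d(x,y)<r\}$. The topology $\tau_d$ consists of all $\mathcal O\subseteq X$ such that for each $x\in\mathcal O$ there is $r>0$ with $B_d(x,r)\subseteq\mathcal O$; continuity of $\rho$ on $X\times X$ refers to $\tau_d\times\tau_d$. Quasi-metrics $d,\rho$ are equivalent if $\kappa^{-1}\rho\le d\le\kappa\rho$ on $X\times X$ for some constant $\kappa>0$. A quasi-metric-measure space $(X,d,\mu)$ is a quasi-metric space with a nonnegative measure $\mu$ on a $\sigma$-algebra containing the Borel sets of $\tau_d$, such that all $d$-balls are measurable and $\mu(B_d(x,r))\in(0,\infty)$ for all $x\in X$, $r\in(0,\infty)$. A family $\mathcal G$ of measurable functions is equi-integrable with respect to $\nu$ if for every $\varepsilon>0$ there is $\delta>0$ such that $\sup_{f\in\mathcal G}\int_A|f|\,d\nu<\varepsilon$ for every measurable $A$ with $\nu(A)<\delta$. A supremum over the empty set in (ii) is $0$. Fractional gradients: for $\alpha\in(0,\infty)$ and measurable $u:X\to\mathbb R$, $\mathbb D^\alpha_d(u)$ is the set of sequences $\vec g=\{g_k\}_{k\in\mathbb Z}$ of nonnegative measurable functions on $X$ for which there is a measurable $E$ with $\mu(E)=0$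 and $|u(x)-u(y)|\le[d(x,y)]^\alpha(g_k(x)+g_k(y))$ for all $k\in\mathbb Z$ and $x,y\in X\setminus E$ with $2^{-k-1}\le d(x,y)<2^{-k}$. The Hajłasz–Triebel–Lizorkin space $M^\alpha_{p,q}(X,d,\mu)$ is the set of $u\in L^p(X,\mu)$ with finite (quasi-)norm $\|u\|_{L^p(X,\mu)}+\inf_{\vec g\in\mathbb D^\alpha_d(u)}\big\|\,\|\{g_k\}_k\|_{\ell^q(\mathbb Z)}\big\|_{L^p(X,\mu)}$; the Hajłasz–Besov space $N^\alpha_{p,q}(X,d,\mu)$ is the set of $u\in L^p(X,\mu)$ with finite (quasi-)norm $\|u\|_{L^p(X,\mu)}+\inf_{\vec g\in\mathbb D^\alpha_d(u)}\big\|\{\|g_k\|_{L^p(X,\mu)}\}_k\big\|_{\ell^q(\mathbb Z)}$. An embedding is compact if the natural map (identity on functions) is well defined and maps bounded sets to totally bounded sets. *)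

theory Defs
  imports "HOL-Analysis.Analysis"
begin

section \<open>Quasi-metric-measure spaces\<close>

definition quasi_metric_on :: "'a set \<Rightarrow> ('a \<Rightarrow> 'a \<Rightarrow> real) \<Rightarrow> bool" where
  "quasi_metric_on X d \<longleftrightarrow>
     (\<exists>x\<in>X. \<exists>y\<in>X. x \<noteq> y) \<and>
     (\<forall>x\<in>X. \<forall>y\<in>X. 0 \<le> d x y) \<and>
     (\<forall>x\<in>X. \<forall>y\<in>X. d x y = 0 \<longleftrightarrow> x = y) \<and>
     (\<exists>C0>0. \<forall>x\<in>X. \<forall>y\<in>X. d y x \<le> C0 * d x y) \<and>
     (\<exists>C1>0. \<forall>x\<in>X. \<forall>y\<in>X. \<forall>z\<in>X. d x y \<le> C1 * max (d x z) (d z y))"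

definition symmetric_on :: "'a set \<Rightarrow> ('a \<Rightarrow> 'a \<Rightarrow> real) \<Rightarrow> bool" where
  "symmetric_on X d \<longleftrightarrow> (\<forall>x\<in>X. \<forall>y\<in>X. d x y = d y x)"

definition quasi_metrics_equivalent ::
    "'a set \<Rightarrow> ('a \<Rightarrow> 'a \<Rightarrow> real) \<Rightarrow> ('a \<Rightarrow> 'a \<Rightarrow> real) \<Rightarrow> bool" where
  "quasi_metrics_equivalent X d \<rho> \<longleftrightarrow>
     (\<exists>\<kappa>>0. \<forall>x\<in>X. \<forall>y\<in>X. inverse \<kappa> * \<rho> x y \<le> d x y \<and> d x y \<le> \<kappa> * \<rho> x y)"

definition qball :: "'a set \<Rightarrow> ('a \<Rightarrow> 'a \<Rightarrow> real) \<Rightarrow> 'a \<Rightarrow> real \<Rightarrow> 'a set" where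
  "qball X d x r = {y \<in> X. d x y < r}"

definition qtopology :: "'a set \<Rightarrow> ('a \<Rightarrow> 'a \<Rightarrow> real) \<Rightarrow> 'a topology" where
  "qtopology X d = topology (\<lambda>U. U \<subseteq> X \<and> (\<forall>x\<in>U. \<exists>r>0. qball X d x r \<subseteq> U))"

lemma openin_qtopology:
  "openin (qtopology X d) U \<longleftrightarrow> U \<subseteq> X \<and> (\<forall>x\<in>U. \<exists>r>0. qball X d x r \<subseteq> U)"
proof -
  let ?P = "\<lambda>U. U \<subseteq> X \<and> (\<forall>x\<in>U. \<exists>r>0. qball X d x r \<subseteq> U)"
  have "istopology ?P"
    unfolding istopology_def
  proof (intro conjI allI impI)
    fix S T assume S: "?P S" and T: "?P T"
    show "S \<inter> T \<subseteq> X" using S by blast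
    show "\<forall>x\<in>S \<inter> T. \<exists>r>0. qball X d x r \<subseteq> S \<inter> T"
    proof
      fix x assume "x \<in> S \<inter> T"
      then obtain r s where "r > 0" "qball X d x r \<subseteq> S" "s > 0" "qball X d x s \<subseteq> T"
        using S T by blast
      then show "\<exists>r>0. qball X d x r \<subseteq> S \<inter> T"
        by (intro exI[of _ "min r s"]) (auto simp: qball_def)
    qed
  next
    fix \<K> assume *: "\<forall>K\<in>\<K>. ?P K"
    then show "\<Union>\<K> \<subseteq> X" by blast
    show "\<forall>x\<in>\<Union>\<K>. \<exists>r>0. qball X d x r \<subseteq> \<Union>\<K>"
      using * by (meson Sup_upper UnionE subset_trans)
  qed
  then show ?thesis
    by (simp add: qtopology_def topology_inverse')
qed

lemma topspace_qtopology: "topspace (qtopology X d) = X"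
proof -
  have "openin (qtopology X d) X"
    unfolding openin_qtopology by (auto simp: qball_def intro!: exI[of _ 1])
  then show ?thesis
    by (metis openin_qtopology openin_subset openin_topspace subset_antisym)
qed

text \<open>The underlying set is \<open>space \<mu>\<close>.\<close>

definition quasi_metric_measure_space :: "('a \<Rightarrow> 'a \<Rightarrow> real) \<Rightarrow> 'a measure \<Rightarrow> bool" where
  "quasi_metric_measure_space d \<mu> \<longleftrightarrow>
     quasi_metric_on (space \<mu>) d \<and>
     sigma_sets (space \<mu>) {U. openin (qtopology (space \<mu>) d) U} \<subseteq> sets \<mu> \<and>
     (\<forall>x\<in>space \<mu>. \<forall>r>0. qball (space \<mu>) d x r \<in> sets \<mu> \<and>
        0 < emeasure \<mu> (qball (space \<mu>) d x r) \<and> emeasure \<mu> (qball (space \<mu>) d x r) < \<infinity>)"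

section \<open>Equi-integrability\<close>

definition equi_integrable :: "'a measure \<Rightarrow> ('a \<Rightarrow> real) set \<Rightarrow> bool" where
  "equi_integrable \<nu> G \<longleftrightarrow>
     G \<subseteq> borel_measurable \<nu> \<and>
     (\<forall>\<epsilon>>0. \<exists>\<delta>>0. \<forall>A\<in>sets \<nu>. emeasure \<nu> A < ennreal \<delta> \<longrightarrow>
        (SUP f\<in>G. \<integral>\<^sup>+x\<in>A. ennreal \<bar>f x\<bar> \<partial>\<nu>) < ennreal \<epsilon>)"

section \<open>Lebesgue, Hajlasz--Triebel--Lizorkin and Hajlasz--Besov spaces\<close>

text \<open>
  (Quasi-)norms take values in \<open>[0,\<infinity>]\<close>. Functions are not identified almost everywhere; the
  identification is accounted for in the definition of a compact embedding below.
\<close>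

definition ennreal_powr :: "ennreal \<Rightarrow> real \<Rightarrow> ennreal" where
  "ennreal_powr a p = (if a = \<infinity> then \<infinity> else ennreal (enn2real a powr p))"

definition Lp_norm :: "'a measure \<Rightarrow> real \<Rightarrow> ('a \<Rightarrow> ennreal) \<Rightarrow> ennreal" where
  "Lp_norm M p f = ennreal_powr (\<integral>\<^sup>+x. ennreal_powr (f x) p \<partial>M) (1 / p)"

definition lq_norm :: "ennreal \<Rightarrow> (int \<Rightarrow> ennreal) \<Rightarrow> ennreal" where
  "lq_norm q a =
     (if q = \<infinity> then (SUP k. a k) else Lp_norm (count_space UNIV) (enn2real q) a)"

definition Lp_fun_norm :: "'a measure \<Rightarrow> real \<Rightarrow> ('a \<Rightarrow> real) \<Rightarrow> ennreal" where
  "Lp_fun_norm M p u = Lp_norm M p (\<lambda>x. ennreal \<bar>u x\<bar>)"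

definition Lp_space :: "'a measure \<Rightarrow> real \<Rightarrow> ('a \<Rightarrow> real) set" where
  "Lp_space M p = {u \<in> borel_measurable M. Lp_fun_norm M p u < \<infinity>}"

definition fractional_gradients ::
    "('a \<Rightarrow> 'a \<Rightarrow> real) \<Rightarrow> 'a measure \<Rightarrow> real \<Rightarrow> ('a \<Rightarrow> real) \<Rightarrow> (int \<Rightarrow> 'a \<Rightarrow> real) set" where
  "fractional_gradients d \<mu> \<alpha> u =
     {g. (\<forall>k. g k \<in> borel_measurable \<mu> \<and> (\<forall>x\<in>space \<mu>. 0 \<le> g k x)) \<and>
         (\<exists>E\<in>null_sets \<mu>. \<forall>k. \<forall>x\<in>space \<mu> - E. \<forall>y\<in>space \<mu> - E.
            2 powi (- k - 1) \<le> d x y \<and> d x y < 2 powi (- k) \<longrightarrow>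
            \<bar>u x - u y\<bar> \<le> d x y powr \<alpha> * (g k x + g k y))}"

text \<open>An infimum over the empty set is \<open>\<infinity>\<close>.\<close>

definition HTL_norm ::
    "('a \<Rightarrow> 'a \<Rightarrow> real) \<Rightarrow> 'a measure \<Rightarrow> real \<Rightarrow> real \<Rightarrow> ennreal \<Rightarrow> ('a \<Rightarrow> real) \<Rightarrow> ennreal" where
  "HTL_norm d \<mu> \<alpha> p q u = Lp_fun_norm \<mu> p u +
     (INF g\<in>fractional_gradients d \<mu> \<alpha> u. Lp_norm \<mu> p (\<lambda>x. lq_norm q (\<lambda>k. ennreal (g k x))))"

definition HB_norm ::
    "('a \<Rightarrow> 'a \<Rightarrow> real) \<Rightarrow> 'a measure \<Rightarrow> real \<Rightarrow> real \<Rightarrow> ennreal \<Rightarrow> ('a \<Rightarrow> real) \<Rightarrow> ennreal" where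
  "HB_norm d \<mu> \<alpha> p q u = Lp_fun_norm \<mu> p u +
     (INF g\<in>fractional_gradients d \<mu> \<alpha> u. lq_norm q (\<lambda>k. Lp_fun_norm \<mu> p (g k)))"

definition HTL_space ::
    "('a \<Rightarrow> 'a \<Rightarrow> real) \<Rightarrow> 'a measure \<Rightarrow> real \<Rightarrow> real \<Rightarrow> ennreal \<Rightarrow> ('a \<Rightarrow> real) set" where
  "HTL_space d \<mu> \<alpha> p q = {u \<in> Lp_space \<mu> p. HTL_norm d \<mu> \<alpha> p q u < \<infinity>}"

definition HB_space ::
    "('a \<Rightarrow> 'a \<Rightarrow> real) \<Rightarrow> 'a measure \<Rightarrow> real \<Rightarrow> real \<Rightarrow> ennreal \<Rightarrow> ('a \<Rightarrow> real) set" where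
  "HB_space d \<mu> \<alpha> p q = {u \<in> Lp_space \<mu> p. HB_norm d \<mu> \<alpha> p q u < \<infinity>}"

section \<open>Compact embeddings\<close>

definition norm_bounded :: "('f \<Rightarrow> ennreal) \<Rightarrow> 'f set \<Rightarrow> bool" where
  "norm_bounded N S \<longleftrightarrow> (\<exists>K::real. \<forall>u\<in>S. N u \<le> ennreal K)"

definition norm_totally_bounded ::
    "(('a \<Rightarrow> real) \<Rightarrow> ennreal) \<Rightarrow> ('a \<Rightarrow> real) set \<Rightarrow> bool" where
  "norm_totally_bounded N S \<longleftrightarrow>
     (\<forall>\<epsilon>>0. \<exists>F. finite F \<and> F \<subseteq> S \<and> (\<forall>u\<in>S. \<exists>v\<in>F. N (\<lambda>x. u x - v x) < ennreal \<epsilon>))"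

text \<open>
  \<open>V\<close> and \<open>W\<close> are spaces of functions taken modulo equality \<open>\<mu>\<close>-a.e. and \<open>\<nu>\<close>-a.e., respectively.
  The first two conjuncts say that the identity on functions induces a well-defined map
  between the two spaces of equivalence classes.
\<close>

definition compact_embedding ::
    "'a measure \<Rightarrow> ('a \<Rightarrow> real) set \<Rightarrow> (('a \<Rightarrow> real) \<Rightarrow> ennreal) \<Rightarrow>
     'a measure \<Rightarrow> ('a \<Rightarrow> real) set \<Rightarrow> (('a \<Rightarrow> real) \<Rightarrow> ennreal) \<Rightarrow> bool" where
  "compact_embedding \<mu> V NV \<nu> W NW \<longleftrightarrow>
     V \<subseteq> W \<and>
     (\<forall>u\<in>V. \<forall>v\<in>V. (AE x in \<mu>. u x = v x) \<longrightarrow> (AE x in \<nu>. u x = v x)) \<and>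
     (\<forall>S\<subseteq>V. norm_bounded NV S \<longrightarrow> norm_totally_bounded NW S)"

end

theory Submission
  imports Defs
begin

text \<open>
  The embeddings are compact because boundedness in either space controls oscillation at small
  distances, and the two hypotheses on \<open>\<nu>\<close> turn this control into uniform integrability and
  tightness with respect to \<open>\<nu>\<close>.

  Let \<open>S\<close> be bounded in one of the two norms. Each \<open>u \<in> S\<close> has a fractional gradient
  \<open>(g k)\<close> whose \<open>L\<^sup>p\<close> norms are bounded uniformly in \<open>k\<close> and \<open>u\<close>, in both
  spaces and for all \<open>q\<close>, because an \<open>\<ell>\<^sup>q\<close> norm dominates the supremum. Summing the contributions of all
  small scales gives \<open>H\<close> with \<open>\<bar>u x - u y\<bar>\<^sup>p \<le> H x + H y\<close> whenever \<open>\<rho> x y < r\<close>, where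
  \<open>\<integral>H d\<mu>\<close> is as small as desired, uniformly in \<open>u \<in> S\<close>, if \<open>r\<close> is small
  (\<open>vanishing_oscillation_of_fractional_gradients\<close>).

  This has two consequences. Averaging \<open>\<bar>u x\<bar>\<^sup>p \<le> 2\<^sup>p (\<bar>u y\<bar>\<^sup>p + H x + H y)\<close> over
  \<open>y\<close> in the \<open>r\<close>-ball of \<open>x\<close>, integrating over \<open>x \<in> A\<close> with respect to \<open>\<nu>\<close> and exchanging
  the integrals bounds the integral of \<open>\<bar>u\<bar>\<^sup>p\<close> over \<open>A\<close> by a multiple of \<open>\<integral>H d\<mu>\<close> plus a multiple
  of the supremum over \<open>y\<close> of the averaging mass of \<open>A\<close>, which is the integral over \<open>A\<close> of the
  functions in the hypotheses. Equi-integrability and decay at infinity therefore make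
  \<open>\<bar>u\<bar>\<^sup>p\<close> uniformly integrable and tight for \<open>\<nu>\<close> (\<open>powr_uniformly_integrable\<close>). Secondly,
  off a set of small measure \<open>u\<close> is bounded and nearly constant on small balls, so on a set of
  finite measure it is described in measure, up to a small error, by finitely many rounded
  values (\<open>totally_bounded_in_measure\<close>). A criterion of Vitali type
  (\<open>Lp_totally_boundedI\<close>) combines the two.
\<close>

section \<open>Powers and \<open>L\<^sup>p\<close> quasi-norms\<close>

text \<open>
  This replaces Minkowski's inequality throughout. It holds for all \<open>p > 0\<close>, so working with
  \<open>p\<close>-th powers instead of norms avoids any distinction between \<open>p < 1\<close> and \<open>p \<ge> 1\<close>.
\<close>

lemma abs_add_powr_le:
  fixes s t p :: real
  assumes "p > 0"
  shows "\<bar>s + t\<bar> powr p \<le> 2 powr p * (\<bar>s\<bar> powr p + \<bar>t\<bar> powr p)"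
proof -
  have "\<bar>s + t\<bar> powr p \<le> (2 * max \<bar>s\<bar> \<bar>t\<bar>) powr p"
    using assms by (intro powr_mono2) auto
  also have "\<dots> = 2 powr p * max \<bar>s\<bar> \<bar>t\<bar> powr p"
    by (simp add: powr_mult)
  also have "\<dots> \<le> 2 powr p * (\<bar>s\<bar> powr p + \<bar>t\<bar> powr p)"
    by (intro mult_left_mono) (auto simp: max_def)
  finally show ?thesis .
qed

lemma ennreal_abs_add_powr_le:
  fixes s t p :: real
  assumes "p > 0"
  shows "ennreal (\<bar>s + t\<bar> powr p)
      \<le> ennreal (2 powr p) * (ennreal (\<bar>s\<bar> powr p) + ennreal (\<bar>t\<bar> powr p))"
  using abs_add_powr_le[OF assms, of s t]
  by (simp flip: ennreal_plus ennreal_mult add: ennreal_leI)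

lemma ennreal_powr_mono:
  assumes "a \<le> b" "p \<ge> 0"
  shows "ennreal_powr a p \<le> ennreal_powr b p"
proof (cases "b = \<infinity>")
  case False
  with assms have "a \<noteq> \<infinity>" "enn2real a \<le> enn2real b"
    by (auto simp: enn2real_mono less_top top_unique)
  then show ?thesis
    using False assms by (auto simp: ennreal_powr_def intro!: ennreal_leI powr_mono2)
qed (simp add: ennreal_powr_def)

lemma ennreal_powr_ennreal: "a \<ge> 0 \<Longrightarrow> ennreal_powr (ennreal a) p = ennreal (a powr p)"
  by (simp add: ennreal_powr_def)

lemma ennreal_powr_powr_inverse:
  assumes "p > 0"
  shows "ennreal_powr (ennreal_powr a p) (1 / p) = a"
  using assms by (cases a) (auto simp: ennreal_powr_def powr_powr)

lemma Lp_fun_norm_eq: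
  "Lp_fun_norm M p u = ennreal_powr (\<integral>\<^sup>+x. ennreal (\<bar>u x\<bar> powr p) \<partial>M) (1 / p)"
  by (simp add: Lp_fun_norm_def Lp_norm_def ennreal_powr_ennreal)

lemma Lp_norm_leD:
  assumes "p > 0" "K \<ge> 0" "Lp_norm M p f \<le> ennreal K"
  shows "(\<integral>\<^sup>+x. ennreal_powr (f x) p \<partial>M) \<le> ennreal (K powr p)"
proof -
  let ?I = "\<integral>\<^sup>+x. ennreal_powr (f x) p \<partial>M"
  have "?I = ennreal_powr (ennreal_powr ?I (1 / p)) p"
    using ennreal_powr_powr_inverse[of "1 / p" ?I] assms(1) by simp
  also have "\<dots> \<le> ennreal_powr (ennreal K) p"
    using assms by (intro ennreal_powr_mono) (auto simp: Lp_norm_def)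
  finally show ?thesis
    using assms by (simp add: ennreal_powr_ennreal)
qed

lemma Lp_fun_norm_leD:
  assumes "p > 0" "K \<ge> 0" "Lp_fun_norm M p u \<le> ennreal K"
  shows "(\<integral>\<^sup>+x. ennreal (\<bar>u x\<bar> powr p) \<partial>M) \<le> ennreal (K powr p)"
  using Lp_norm_leD[OF assms(1,2), of M "\<lambda>x. ennreal \<bar>u x\<bar>"] assms(3)
  by (simp add: Lp_fun_norm_def ennreal_powr_ennreal)

lemma Lp_fun_norm_less_top_iff:
  assumes "p > 0"
  shows "Lp_fun_norm M p u < \<infinity> \<longleftrightarrow> (\<integral>\<^sup>+x. ennreal (\<bar>u x\<bar> powr p) \<partial>M) < \<infinity>"
  by (auto simp: Lp_fun_norm_eq ennreal_powr_def less_top)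

lemma Lp_fun_norm_lessI:
  assumes "p > 0" "\<epsilon> > 0" "(\<integral>\<^sup>+x. ennreal (\<bar>u x\<bar> powr p) \<partial>M) < ennreal (\<epsilon> powr p)"
  shows "Lp_fun_norm M p u < ennreal \<epsilon>"
proof (rule ccontr)
  assume "\<not> Lp_fun_norm M p u < ennreal \<epsilon>"
  then have "ennreal_powr (ennreal \<epsilon>) p \<le> ennreal_powr (Lp_fun_norm M p u) p"
    using assms by (intro ennreal_powr_mono) auto
  also have "\<dots> = (\<integral>\<^sup>+x. ennreal (\<bar>u x\<bar> powr p) \<partial>M)"
    unfolding Lp_fun_norm_eq
    using ennreal_powr_powr_inverse[of "1 / p"] assms(1) by simp
  finally show False
    using assms by (simp add: ennreal_powr_ennreal)
qed

text \<open>
  Through this comparison with the supremum, every \<open>q\<close> reduces to \<open>q = \<infinity>\<close>.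
\<close>

lemma le_lq_norm:
  assumes "q > 0"
  shows "a k \<le> lq_norm q a"
proof (cases "q = \<infinity>")
  case True
  then show ?thesis by (auto simp: lq_norm_def intro: SUP_upper)
next
  case False
  then have q: "enn2real q > 0"
    using assms by (simp add: enn2real_positive_iff less_top)
  have "ennreal_powr (a k) (enn2real q)
      = (\<integral>\<^sup>+j. ennreal_powr (a j) (enn2real q) * indicator {k} j \<partial>count_space UNIV)"
    by (subst nn_integral_indicator_singleton) auto
  also have "\<dots> \<le> (\<integral>\<^sup>+j. ennreal_powr (a j) (enn2real q) \<partial>count_space UNIV)"
    by (intro nn_integral_mono) (auto split: split_indicator)
  finally have "a k \<le> ennreal_powr (\<integral>\<^sup>+j. ennreal_powr (a j) (enn2real q) \<partial>count_space UNIV)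
      (1 / enn2real q)"
    using ennreal_powr_mono[of _ _ "1 / enn2real q"] ennreal_powr_powr_inverse[OF q, of "a k"] q
    by (metis divide_nonneg_pos less_eq_real_def zero_le_one)
  then show ?thesis
    using False by (simp add: lq_norm_def Lp_norm_def)
qed

lemma nn_integral_le_dominated:
  assumes sets: "sets \<nu> = sets \<mu>"
    and le: "\<And>A. A \<in> sets \<mu> \<Longrightarrow> emeasure \<nu> A \<le> c * emeasure \<mu> A"
  shows "(\<integral>\<^sup>+x. f x \<partial>\<nu>) \<le> c * (\<integral>\<^sup>+x. f x \<partial>\<mu>)"
proof -
  have space: "space \<nu> = space \<mu>"
    using sets by (rule sets_eq_imp_space_eq)
  have "integral\<^sup>S \<nu> g \<le> c * (\<integral>\<^sup>+x. f x \<partial>\<mu>)" if "simple_function \<nu> g" "g \<le> f" for g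
  proof -
    have g: "simple_function \<mu> g"
      using that by (simp add: simple_function_def sets space)
    have "integral\<^sup>S \<nu> g \<le> (\<Sum>y\<in>g ` space \<mu>. y * (c * emeasure \<mu> (g -` {y} \<inter> space \<mu>)))"
      unfolding simple_integral_def space
      using g by (intro sum_mono mult_left_mono le) (auto simp: simple_function_def)
    also have "\<dots> = c * integral\<^sup>S \<mu> g"
      unfolding simple_integral_def by (simp add: sum_distrib_left ac_simps)
    also have "\<dots> \<le> c * (\<integral>\<^sup>+x. f x \<partial>\<mu>)"
      unfolding nn_integral_def using g that(2) by (intro mult_left_mono SUP_upper) auto
    finally show ?thesis .
  qed
  then show ?thesis
    unfolding nn_integral_def[of \<nu>] by (auto intro!: SUP_least)
qed

section \<open>A Vitali-type criterion for total boundedness in \<open>L\<^sup>p\<close>\<close>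

text \<open>
  The first hypothesis is uniform integrability of the \<open>p\<close>-th powers together with tightness, in
  one formula: \<open>A\<close> may have large or infinite measure as long as it meets \<open>B\<close> in a small set.
  The second one is total boundedness in measure on sets of finite measure, in a form that needs no metric:
  the label \<open>P u\<close> takes finitely many values, and equal labels force closeness in measure. For
  \<open>P u = P v\<close> the hypotheses apply to the set \<open>A\<close> on which \<open>B\<close> fails or
  \<open>\<bar>u - v\<bar> > \<theta>\<close>; off \<open>A\<close> the difference is at most \<open>\<theta>\<close>.
\<close>

lemma Lp_totally_boundedI:
  fixes S :: "('a \<Rightarrow> real) set" and \<nu> :: "'a measure"
  assumes p: "p > 0" and S: "S \<subseteq> borel_measurable \<nu>"
    and unif: "\<And>\<epsilon>::real. \<epsilon> > 0 \<Longrightarrow> \<exists>B\<in>sets \<nu>. \<exists>\<delta>>0. emeasure \<nu> B < \<infinity> \<and>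
      (\<forall>A\<in>sets \<nu>. emeasure \<nu> (A \<inter> B) < ennreal \<delta> \<longrightarrow>
        (\<forall>u\<in>S. (\<integral>\<^sup>+x\<in>A. ennreal (\<bar>u x\<bar> powr p) \<partial>\<nu>) \<le> ennreal \<epsilon>))"
    and meas: "\<And>B \<delta> \<theta>. B \<in> sets \<nu> \<Longrightarrow> emeasure \<nu> B < \<infinity> \<Longrightarrow> (\<delta>::real) > 0 \<Longrightarrow> (\<theta>::real) > 0 \<Longrightarrow>
      \<exists>P :: ('a \<Rightarrow> real) \<Rightarrow> 'b. finite (P ` S) \<and>
        (\<forall>u\<in>S. \<forall>v\<in>S. P u = P v \<longrightarrow> emeasure \<nu> {x\<in>B. \<bar>u x - v x\<bar> > \<theta>} < ennreal \<delta>)"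
  shows "norm_totally_bounded (Lp_fun_norm \<nu> p) S"
  unfolding norm_totally_bounded_def
proof (intro allI impI)
  fix \<epsilon> :: real assume "\<epsilon> > 0"
  define e where "e = \<epsilon> powr p"
  \<comment> \<open>The constants make both the exceptional set and the rest contribute at most \<open>e / 3\<close>.\<close>
  define e' where "e' = e / (6 * 2 powr p)"
  have e: "e > 0" "e' > 0"
    using \<open>\<epsilon> > 0\<close> by (auto simp: e_def e'_def)
  obtain B \<delta> where B: "B \<in> sets \<nu>" "emeasure \<nu> B < \<infinity>" and \<delta>: "\<delta> > 0"
    and small: "\<And>A u. A \<in> sets \<nu> \<Longrightarrow> emeasure \<nu> (A \<inter> B) < ennreal \<delta> \<Longrightarrow> u \<in> S \<Longrightarrow>
      (\<integral>\<^sup>+x\<in>A. ennreal (\<bar>u x\<bar> powr p) \<partial>\<nu>) \<le> ennreal e'"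
    using unif[OF e(2)] by metis
  define b where "b = measure \<nu> B"
  have b: "b \<ge> 0" "emeasure \<nu> B = ennreal b"
    using B by (auto simp: b_def emeasure_eq_ennreal_measure)
  define \<theta> where "\<theta> = (e / (3 * (b + 1))) powr (1 / p)"
  have \<theta>: "\<theta> > 0" "\<theta> powr p = e / (3 * (b + 1))"
    using e b p by (auto simp: \<theta>_def powr_powr)
  obtain P :: "('a \<Rightarrow> real) \<Rightarrow> 'b" where P: "finite (P ` S)"
    "\<And>u v. u \<in> S \<Longrightarrow> v \<in> S \<Longrightarrow> P u = P v \<Longrightarrow> emeasure \<nu> {x\<in>B. \<bar>u x - v x\<bar> > \<theta>} < ennreal \<delta>"
    using meas[OF B \<delta> \<theta>(1)] by metis
  have close: "Lp_fun_norm \<nu> p (\<lambda>x. u x - v x) < ennreal \<epsilon>"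
    if uv: "u \<in> S" "v \<in> S" "P u = P v" for u v
  proof (rule Lp_fun_norm_lessI[OF p \<open>\<epsilon> > 0\<close>])
    have [measurable]: "u \<in> borel_measurable \<nu>" "v \<in> borel_measurable \<nu>" "B \<in> sets \<nu>"
      using uv S B by auto
    define A where "A = {x\<in>space \<nu>. x \<notin> B \<or> \<bar>u x - v x\<bar> > \<theta>}"
    have A: "A \<in> sets \<nu>"
      unfolding A_def by measurable
    have "A \<inter> B = {x\<in>B. \<bar>u x - v x\<bar> > \<theta>}"
      using sets.sets_into_space[OF B(1)] by (auto simp: A_def)
    with P(2)[OF uv] have AB: "emeasure \<nu> (A \<inter> B) < ennreal \<delta>"
      by simp
    have "(\<integral>\<^sup>+x. ennreal (\<bar>u x - v x\<bar> powr p) \<partial>\<nu>)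
       \<le> (\<integral>\<^sup>+x. ennreal (2 powr p) * (ennreal (\<bar>u x\<bar> powr p) * indicator A x
            + ennreal (\<bar>v x\<bar> powr p) * indicator A x) + ennreal (\<theta> powr p) * indicator B x \<partial>\<nu>)"
    proof (rule nn_integral_mono)
      fix x assume x: "x \<in> space \<nu>"
      show "ennreal (\<bar>u x - v x\<bar> powr p)
        \<le> ennreal (2 powr p) * (ennreal (\<bar>u x\<bar> powr p) * indicator A x
            + ennreal (\<bar>v x\<bar> powr p) * indicator A x) + ennreal (\<theta> powr p) * indicator B x"
      proof (cases "x \<in> A")
        case True
        then show ?thesis
          using ennreal_abs_add_powr_le[OF p, of "u x" "- v x"]
          by (auto intro: order_trans add_increasing2)
      next
        case False
        with x have "x \<in> B" "\<bar>u x - v x\<bar> \<le> \<theta>" by (auto simp: A_def)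
        then show ?thesis
          using False p by (auto intro!: ennreal_leI powr_mono2)
      qed
    qed
    also have "\<dots> = ennreal (2 powr p) * ((\<integral>\<^sup>+x\<in>A. ennreal (\<bar>u x\<bar> powr p) \<partial>\<nu>)
            + (\<integral>\<^sup>+x\<in>A. ennreal (\<bar>v x\<bar> powr p) \<partial>\<nu>)) + ennreal (\<theta> powr p) * emeasure \<nu> B"
      using A B by (simp add: nn_integral_add nn_integral_cmult)
    also have "\<dots> \<le> ennreal (2 powr p) * (ennreal e' + ennreal e') + ennreal (\<theta> powr p) * ennreal b"
      using small[OF A AB] uv b by (intro add_mono mult_left_mono) auto
    also have "\<dots> = ennreal (2 powr p * (e' + e') + \<theta> powr p * b)"
      using e b by (simp flip: ennreal_plus ennreal_mult)
    also have "\<dots> < ennreal (\<epsilon> powr p)"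
    proof (rule ennreal_lessI)
      have "\<theta> powr p * b \<le> \<theta> powr p * (b + 1)"
        by (intro mult_left_mono) auto
      also have "\<dots> = e / 3"
        using \<theta>(2) b(1) by (simp add: divide_simps algebra_simps)
      finally have "\<theta> powr p * b \<le> e / 3" .
      moreover have "2 powr p * (e' + e') = e / 3"
        by (simp add: e'_def field_simps)
      ultimately show "2 powr p * (e' + e') + \<theta> powr p * b < \<epsilon> powr p"
        using e(1) unfolding e_def by linarith
    qed (use \<open>\<epsilon> > 0\<close> in simp)
    finally show "(\<integral>\<^sup>+x. ennreal (\<bar>u x - v x\<bar> powr p) \<partial>\<nu>) < ennreal (\<epsilon> powr p)" .
  qed
  \<comment> \<open>One representative for each label is an \<open>\<epsilon>\<close>-net inside \<open>S\<close>.\<close>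
  obtain F where F: "F \<subseteq> S" "finite F" "P ` S = P ` F"
    using finite_subset_image[OF P(1), of P S] by blast
  then have "\<forall>u\<in>S. \<exists>v\<in>F. Lp_fun_norm \<nu> p (\<lambda>x. u x - v x) < ennreal \<epsilon>"
    using close by (metis (no_types, lifting) imageE imageI subsetD)
  with F show "\<exists>F. finite F \<and> F \<subseteq> S \<and> (\<forall>u\<in>S. \<exists>v\<in>F. Lp_fun_norm \<nu> p (\<lambda>x. u x - v x) < ennreal \<epsilon>)"
    by blast
qed

section \<open>Quasi-metric measure spaces with a dominated second measure\<close>

text \<open>
  In the application \<open>M\<close> and \<open>N\<close> are \<open>\<mu>\<close> and \<open>\<nu>\<close>, and \<open>\<rho>\<close> is the regularised quasi-metric.
  Balls of a quasi-metric need not be open, and \<open>\<rho>\<close> need not be jointly measurable; upper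
  semicontinuity of \<open>\<rho>\<close>, expressed through its own balls, is the part of continuity that makes
  \<open>{(x, y). \<rho> x y < r}\<close> measurable in the product.
\<close>

locale dominated_quasi_metric_measure =
  fixes M N :: "'a measure" and \<rho> :: "'a \<Rightarrow> 'a \<Rightarrow> real" and c C :: real
  assumes self: "x \<in> space M \<Longrightarrow> \<rho> x x = 0"
    and commute: "x \<in> space M \<Longrightarrow> y \<in> space M \<Longrightarrow> \<rho> x y = \<rho> y x"
    and c_ge_1: "1 \<le> c"
    and triangle: "x \<in> space M \<Longrightarrow> y \<in> space M \<Longrightarrow> z \<in> space M \<Longrightarrow>
      \<rho> x y \<le> c * max (\<rho> x z) (\<rho> z y)"
    and ball_sets: "x \<in> space M \<Longrightarrow> qball (space M) \<rho> x r \<in> sets M"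
    and ball_pos: "x \<in> space M \<Longrightarrow> r > 0 \<Longrightarrow> 0 < emeasure M (qball (space M) \<rho> x r)"
    and ball_finite: "x \<in> space M \<Longrightarrow> r > 0 \<Longrightarrow> emeasure M (qball (space M) \<rho> x r) < \<infinity>"
    and upper_semicontinuous: "x \<in> space M \<Longrightarrow> y \<in> space M \<Longrightarrow> \<rho> x y < r \<Longrightarrow>
      \<exists>s>0. \<forall>x'\<in>qball (space M) \<rho> x s. \<forall>y'\<in>qball (space M) \<rho> y s. \<rho> x' y' < r"
    and sets_N: "sets N = sets M"
    and C_pos: "C > 0"
    and dominated: "A \<in> sets M \<Longrightarrow> emeasure N A \<le> ennreal C * emeasure M A"
begin

abbreviation B :: "'a \<Rightarrow> real \<Rightarrow> 'a set" where
  "B \<equiv> qball (space M) \<rho>"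

lemma space_N: "space N = space M"
  using sets_N by (rule sets_eq_imp_space_eq)

lemma measurable_N: "borel_measurable N = borel_measurable M"
  by (rule measurable_cong_sets[OF sets_N refl])

lemma less_scaled_triangle:
  assumes "x \<in> space M" "y \<in> space M" "z \<in> space M" "\<rho> x z < s" "\<rho> z y < s"
  shows "\<rho> x y < c * s"
proof -
  have "c * max (\<rho> x z) (\<rho> z y) < c * s"
    using assms c_ge_1 by (intro mult_strict_left_mono) auto
  with triangle[OF assms(1-3)] show ?thesis by linarith
qed

text \<open>
  Separability comes from the measure. Points of a bounded set around which the balls of radius
  \<open>\<epsilon> / c\<close> have measure more than \<open>1 / (k + 1)\<close> admit only boundedly many \<open>\<epsilon>\<close>-separated
  elements, since the balls around separated points are disjoint and lie in one ball of finite
  measure. A separated subset of maximal cardinality is a net for these points, and countably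
  many such classes exhaust the space because every ball has positive measure.
\<close>

lemma countable_net:
  assumes "\<epsilon> > 0"
  obtains D where "countable D" "D \<subseteq> space M" "space M = (\<Union>z\<in>D. B z \<epsilon>)"
proof (cases "space M = {}")
  case True
  then show ?thesis using that[of "{}"] by auto
next
  case False
  then obtain x0 where x0: "x0 \<in> space M" by blast
  define \<eta> where "\<eta> = \<epsilon> / c"
  have \<eta>: "\<eta> > 0" "c * \<eta> = \<epsilon>"
    using assms c_ge_1 by (auto simp: \<eta>_def)
  define L where "L m k = {x\<in>B x0 (real m). ennreal (1 / real (Suc k)) < emeasure M (B x \<eta>)}" for m k
  define sep where "sep m k F \<longleftrightarrow> finite F \<and> F \<subseteq> L m k \<and> (\<forall>z\<in>F. \<forall>w\<in>F. z \<noteq> w \<longrightarrow> \<epsilon> \<le> \<rho> z w)" for m k F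
  have L_sub: "L m k \<subseteq> space M" for m k
    by (auto simp: L_def qball_def)
  have "\<exists>F. sep m k F \<and> (\<forall>x\<in>L m k. \<exists>z\<in>F. \<rho> z x < \<epsilon>)" for m k
  proof -
    define W where "W = B x0 (c * max (real m) \<eta>)"
    have W: "W \<in> sets M" "emeasure M W < \<infinity>"
      unfolding W_def by (rule ball_sets[OF x0], rule ball_finite[OF x0]) (use c_ge_1 \<eta> in auto)
    have card: "card F \<le> nat \<lceil>measure M W * real (Suc k)\<rceil>" if F: "sep m k F" for F
    proof -
      have disj: "disjoint_family_on (\<lambda>z. B z \<eta>) F"
        unfolding disjoint_family_on_def
      proof (intro ballI impI equals0I)
        fix z w x assume *: "z \<in> F" "w \<in> F" "z \<noteq> w" "x \<in> B z \<eta> \<inter> B w \<eta>"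
        then have sp: "z \<in> space M" "w \<in> space M" "x \<in> space M"
          using F L_sub by (auto simp: sep_def qball_def)
        have "\<rho> z w < c * \<eta>"
          using * by (intro less_scaled_triangle[OF sp]) (auto simp: qball_def commute[OF sp(3,2)])
        moreover have "\<epsilon> \<le> \<rho> z w"
          using * F by (simp add: sep_def)
        ultimately show False using \<eta> by simp
      qed
      have sub: "(\<Union>z\<in>F. B z \<eta>) \<subseteq> W"
      proof safe
        fix z x assume z: "z \<in> F" "x \<in> B z \<eta>"
        then have "z \<in> B x0 (real m)"
          using F by (auto simp: sep_def L_def)
        with z show "x \<in> W"
          using less_scaled_triangle[OF x0, of x z "max (real m) \<eta>"] by (auto simp: W_def qball_def)
      qed
      have "ennreal (real (card F) * (1 / real (Suc k))) = (\<Sum>z\<in>F. ennreal (1 / real (Suc k)))"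
        by (simp only: sum_constant ennreal_of_nat_eq_real_of_nat) (rule ennreal_mult, simp_all)
      also have "\<dots> \<le> (\<Sum>z\<in>F. emeasure M (B z \<eta>))"
        using F by (intro sum_mono) (auto simp: sep_def L_def)
      also have "\<dots> = emeasure M (\<Union>z\<in>F. B z \<eta>)"
        using F disj L_sub by (intro sum_emeasure) (auto simp: sep_def intro!: ball_sets)
      also have "\<dots> \<le> emeasure M W"
        using sub W by (intro emeasure_mono)
      also have "\<dots> = ennreal (measure M W)"
        using W by (simp add: emeasure_eq_ennreal_measure)
      finally have "real (card F) * (1 / real (Suc k)) \<le> measure M W"
        by simp
      then have "real (card F) \<le> measure M W * real (Suc k)"
        by (simp add: field_simps)
      then show ?thesis by linarith
    qed
    have "sep m k {}" by (simp add: sep_def)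
    then have "\<exists>F. sep m k F \<and> (\<forall>G. sep m k G \<longrightarrow> card G \<le> card F)"
      by (rule ex_has_greatest_nat) (use card in \<open>auto intro!: le_imp_less_Suc\<close>)
    then obtain F where F: "sep m k F" and max: "\<And>G. sep m k G \<Longrightarrow> card G \<le> card F"
      by auto
    have "\<exists>z\<in>F. \<rho> z x < \<epsilon>" if x: "x \<in> L m k" for x
    proof (rule ccontr)
      assume *: "\<not> (\<exists>z\<in>F. \<rho> z x < \<epsilon>)"
      have "\<rho> x x = 0"
        using x L_sub by (intro self) blast
      with * have "x \<notin> F"
        using assms by auto
      moreover have "\<rho> x z = \<rho> z x" if "z \<in> F" for z
        using that x F L_sub[of m k] by (intro commute) (auto simp: sep_def)
      with * F x have "sep m k (insert x F)"
        by (auto simp: sep_def not_less)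
      ultimately show False
        using max[of "insert x F"] F by (simp add: sep_def)
    qed
    with F show ?thesis by blast
  qed
  then obtain F where F: "\<And>m k. sep m k (F m k)"
    "\<And>m k x. x \<in> L m k \<Longrightarrow> \<exists>z\<in>F m k. \<rho> z x < \<epsilon>"
    by metis
  show ?thesis
  proof (rule that[of "\<Union>m k. F m k"])
    show "countable (\<Union>m k. F m k)"
      using F(1) unfolding sep_def by (intro countable_UN countableI_type countable_finite) blast
    show *: "(\<Union>m k. F m k) \<subseteq> space M"
      using F(1) L_sub by (fastforce simp: sep_def)
    have "\<exists>m k. x \<in> L m k" if x: "x \<in> space M" for x
    proof -
      obtain m where m: "\<rho> x0 x < real m"
        using reals_Archimedean2 by blast
      have "0 < emeasure M (B x \<eta>)" "emeasure M (B x \<eta>) < \<infinity>"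
        using ball_pos[OF x \<eta>(1)] ball_finite[OF x \<eta>(1)] by auto
      then have *: "0 < measure M (B x \<eta>)" "emeasure M (B x \<eta>) = ennreal (measure M (B x \<eta>))"
        by (auto simp: emeasure_eq_ennreal_measure)
      obtain k where "1 / real (Suc k) < measure M (B x \<eta>)"
        using nat_approx_posE[OF *(1)] by blast
      with m x * show ?thesis
        by (intro exI[of _ m] exI[of _ k]) (simp add: L_def qball_def ennreal_less_iff)
    qed
    then show "space M = (\<Union>z\<in>(\<Union>m k. F m k). B z \<epsilon>)"
      using F(2) by (fastforce simp: qball_def)
  qed
qed

text \<open>
  The set is open for the product of the ball topologies, by semicontinuity; hence it is the union
  of the products of balls of radius \<open>1 / (n + 1)\<close> that it contains and whose centres are taken
  from a countable net of that fineness, over all \<open>n\<close>.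
\<close>

lemma sets_pair_less:
  "{(x, y) \<in> space M \<times> space M. \<rho> x y < r} \<in> sets (M \<Otimes>\<^sub>M M)"
proof -
  let ?W = "{(x, y) \<in> space M \<times> space M. \<rho> x y < r}"
  define s where "s n = 1 / real (Suc n)" for n
  have "\<exists>D. countable D \<and> D \<subseteq> space M \<and> space M = (\<Union>z\<in>D. B z (s n))" for n
    using countable_net[of "s n"] by (metis s_def of_nat_0_less_iff zero_less_Suc zero_less_divide_1_iff)
  then obtain D where D: "\<And>n. countable (D n)" "\<And>n. D n \<subseteq> space M"
    "\<And>n. space M = (\<Union>z\<in>D n. B z (s n))"
    by metis
  define Q where "Q n = {(z, w) \<in> D n \<times> D n. B z (s n) \<times> B w (s n) \<subseteq> ?W}" for n
  have "?W = (\<Union>n. \<Union>(z, w)\<in>Q n. B z (s n) \<times> B w (s n))"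
  proof (intro equalityI subsetI)
    fix a assume "a \<in> ?W"
    then obtain x y where xy: "a = (x, y)" "x \<in> space M" "y \<in> space M" "\<rho> x y < r"
      by auto
    obtain t where t: "t > 0" "\<And>x' y'. x' \<in> B x t \<Longrightarrow> y' \<in> B y t \<Longrightarrow> \<rho> x' y' < r"
      using upper_semicontinuous[OF xy(2-4)] by blast
    obtain n where n: "s n < t / c"
      using nat_approx_posE[of "t / c"] t c_ge_1 unfolding s_def by auto
    have ball: "B z (s n) \<subseteq> B v t" if "z \<in> space M" "v \<in> B z (s n)" for z v
    proof
      fix w assume w: "w \<in> B z (s n)"
      have "\<rho> v w < c * s n"
        using that w by (intro less_scaled_triangle[of v w z]) (auto simp: qball_def commute)
      also have "\<dots> < t"
        using n c_ge_1 by (simp add: field_simps)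
      finally show "w \<in> B v t"
        using w by (auto simp: qball_def)
    qed
    obtain z w where zw: "z \<in> D n" "x \<in> B z (s n)" "w \<in> D n" "y \<in> B w (s n)"
      using xy D(3)[of n] by blast
    have "B z (s n) \<times> B w (s n) \<subseteq> ?W"
      using ball[of z x] ball[of w y] zw D(2)[of n] t(2) by (auto simp: qball_def subset_iff)
    with zw have "(z, w) \<in> Q n" by (simp add: Q_def)
    with zw xy show "a \<in> (\<Union>n. \<Union>(z, w)\<in>Q n. B z (s n) \<times> B w (s n))" by blast
  qed (auto simp: Q_def)
  also have "\<dots> \<in> sets (M \<Otimes>\<^sub>M M)"
  proof (intro sets.countable_UN'' sets.countable_UN' countableI_type)
    fix n
    have "Q n \<subseteq> D n \<times> D n" by (auto simp: Q_def)
    then show "countable (Q n)"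
      using D(1) by (meson countable_SIGMA countable_subset)
    fix a assume "a \<in> Q n"
    then show "(case a of (z, w) \<Rightarrow> B z (s n) \<times> B w (s n)) \<in> sets (M \<Otimes>\<^sub>M M)"
      using D(2) by (auto simp: Q_def intro!: pair_measureI ball_sets)
  qed
  finally show ?thesis .
qed

lemma emeasure_N_finite:
  assumes "A \<in> sets M" "emeasure M A < \<infinity>"
  shows "emeasure N A < \<infinity>"
  using dominated[OF assms(1)] assms(2)
  by (metis ennreal_mult_less_top ennreal_less_top infinity_ennreal_def order_le_less_trans)

lemma sigma_finite_M: "sigma_finite_measure M" and sigma_finite_N: "sigma_finite_measure N"
proof -
  obtain D where D: "countable D" "D \<subseteq> space M" "space M = (\<Union>z\<in>D. B z 1)"
    using countable_net[of 1] by auto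
  have *: "countable ((\<lambda>z. B z 1) ` D)" "(\<lambda>z. B z 1) ` D \<subseteq> sets M"
    "\<Union>((\<lambda>z. B z 1) ` D) = space M"
    using D ball_sets by auto
  have fin: "\<And>a. a \<in> (\<lambda>z. B z 1) ` D \<Longrightarrow> emeasure M a < \<infinity>"
    using D(2) ball_finite[of _ 1] by auto
  show "sigma_finite_measure M"
    using * fin by (intro sigma_finite_measure.intro exI[of _ "(\<lambda>z. B z 1) ` D"])
      (auto simp: less_top)
  have "\<And>a. a \<in> (\<lambda>z. B z 1) ` D \<Longrightarrow> emeasure N a \<noteq> \<infinity>"
    using * fin emeasure_N_finite by (metis less_irrefl subsetD)
  with * show "sigma_finite_measure N"
    by (intro sigma_finite_measure.intro exI[of _ "(\<lambda>z. B z 1) ` D"])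
      (auto simp: sets_N space_N)
qed

section \<open>Averaging over small balls\<close>

lemma measurable_emeasure_ball: "(\<lambda>x. emeasure M (B x r)) \<in> borel_measurable M"
proof -
  interpret sigma_finite_measure M by (rule sigma_finite_M)
  have "(\<lambda>x. emeasure M (Pair x -` {(x, y) \<in> space M \<times> space M. \<rho> x y < r})) \<in> borel_measurable M"
    by (rule measurable_emeasure_Pair[OF sets_pair_less])
  then show ?thesis
    by (rule measurable_cong[THEN iffD1, rotated]) (auto simp: qball_def intro!: arg_cong[of _ _ "emeasure M"])
qed

text \<open>
  The kernel that appears when ball averages with respect to \<open>M\<close> are integrated over \<open>A\<close> with
  respect to \<open>N\<close> and the order of integration is exchanged. Both hypotheses on \<open>\<nu>\<close> in the
  embedding theorem are bounds for it.
\<close>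

definition averaging_mass :: "real \<Rightarrow> 'a set \<Rightarrow> 'a \<Rightarrow> ennreal" where
  "averaging_mass r A y = (\<integral>\<^sup>+x\<in>A. indicator (B y r) x / emeasure M (B x r) \<partial>N)"

lemma nn_integral_ball_average:
  assumes [measurable]: "f \<in> borel_measurable M" "A \<in> sets M" and r: "r > 0"
  shows "(\<integral>\<^sup>+x\<in>A. (\<integral>\<^sup>+y\<in>B x r. f y \<partial>M) / emeasure M (B x r) \<partial>N)
    = (\<integral>\<^sup>+y. f y * averaging_mass r A y \<partial>M)"
proof -
  interpret M: sigma_finite_measure M by (rule sigma_finite_M)
  interpret N: sigma_finite_measure N by (rule sigma_finite_N)
  interpret pair_sigma_finite M N ..
  note [measurable_cong] = sets_N
  define W where "W = {(x, y) \<in> space M \<times> space M. \<rho> x y < r}"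
  have [measurable]: "W \<in> sets (M \<Otimes>\<^sub>M M)"
    unfolding W_def by (rule sets_pair_less)
  note [measurable] = measurable_emeasure_ball
  let ?F = "\<lambda>y x. f y * (indicator W (y, x) / emeasure M (B x r) * indicator A x)"
  have ind_W: "indicator W (y, x) = (indicator (B x r) y :: ennreal)"
     "indicator W (y, x) = (indicator (B y r) x :: ennreal)"
    if "x \<in> space M" "y \<in> space M" for x y
    using that commute[OF that] by (auto simp: W_def qball_def split: split_indicator)
  have "(\<integral>\<^sup>+x\<in>A. (\<integral>\<^sup>+y\<in>B x r. f y \<partial>M) / emeasure M (B x r) \<partial>N) = (\<integral>\<^sup>+x. \<integral>\<^sup>+y. ?F y x \<partial>M \<partial>N)"
  proof (rule nn_integral_cong)
    fix x assume "x \<in> space N"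
    then have x: "x \<in> space M" by (simp add: space_N)
    note [measurable] = ball_sets[OF x]
    have "(\<integral>\<^sup>+y. ?F y x \<partial>M)
        = (\<integral>\<^sup>+y. (f y * indicator (B x r) y) * (inverse (emeasure M (B x r)) * indicator A x) \<partial>M)"
      using x by (intro nn_integral_cong) (simp add: ind_W(1) divide_ennreal_def mult_ac)
    also have "\<dots> = (\<integral>\<^sup>+y. f y * indicator (B x r) y \<partial>M) * (inverse (emeasure M (B x r)) * indicator A x)"
      by (rule nn_integral_multc) measurable
    finally show "(\<integral>\<^sup>+y\<in>B x r. f y \<partial>M) / emeasure M (B x r) * indicator A x = (\<integral>\<^sup>+y. ?F y x \<partial>M)"
      by (simp add: divide_ennreal_def mult_ac)
  qed
  also have "\<dots> = (\<integral>\<^sup>+y. \<integral>\<^sup>+x. ?F y x \<partial>N \<partial>M)"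
    by (rule Fubini') measurable
  also have "\<dots> = (\<integral>\<^sup>+y. f y * averaging_mass r A y \<partial>M)"
  proof (rule nn_integral_cong)
    fix y assume y: "y \<in> space M"
    note [measurable] = ball_sets[OF y]
    have "(\<integral>\<^sup>+x. ?F y x \<partial>N) = (\<integral>\<^sup>+x. f y * (indicator (B y r) x / emeasure M (B x r) * indicator A x) \<partial>N)"
      using y by (intro nn_integral_cong) (simp add: ind_W(2) space_N)
    also have "\<dots> = f y * averaging_mass r A y"
      unfolding averaging_mass_def by (rule nn_integral_cmult) measurable
    finally show "(\<integral>\<^sup>+x. ?F y x \<partial>N) = f y * averaging_mass r A y" .
  qed
  finally show ?thesis .
qed

text \<open>
  For \<open>y\<close> in the ball around \<open>x\<close>, \<open>\<bar>u x\<bar>\<^sup>p\<close> is at most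
  \<open>2\<^sup>p (\<bar>u y\<bar>\<^sup>p + H x + H y)\<close>. Averaging over \<open>y\<close> and integrating over \<open>x\<close> leaves two
  terms. The one with \<open>H x\<close> is controlled by \<open>N \<le> C M\<close> and is small with \<open>\<integral>H\<close>, whatever
  \<open>A\<close> is; the other carries the averaging mass of \<open>A\<close> as a factor. Only the \<open>p\<close>-th powers
  are averaged, so \<open>u\<close> itself need not be locally integrable.
\<close>

lemma set_nn_integral_powr_le:
  assumes p: "p > 0" and r: "r > 0"
    and [measurable]: "u \<in> borel_measurable M" "H \<in> borel_measurable M" "A \<in> sets M"
    and osc: "\<And>x y. x \<in> space M \<Longrightarrow> y \<in> space M \<Longrightarrow> \<rho> x y < r \<Longrightarrow>
      ennreal (\<bar>u x - u y\<bar> powr p) \<le> H x + H y"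
    and mass: "\<And>y. y \<in> space M \<Longrightarrow> averaging_mass r A y \<le> t"
  shows "(\<integral>\<^sup>+x\<in>A. ennreal (\<bar>u x\<bar> powr p) \<partial>N)
    \<le> ennreal (2 powr p) * (ennreal C * (\<integral>\<^sup>+x. H x \<partial>M)
        + ((\<integral>\<^sup>+x. ennreal (\<bar>u x\<bar> powr p) \<partial>M) + (\<integral>\<^sup>+x. H x \<partial>M)) * t)"
proof -
  interpret M: sigma_finite_measure M by (rule sigma_finite_M)
  note [measurable_cong] = sets_N
  note [measurable] = measurable_emeasure_ball sets_pair_less
  define k where "k = ennreal (2 powr p)"
  define f where "f y = ennreal (\<bar>u y\<bar> powr p) + H y" for y
  have f[measurable]: "f \<in> borel_measurable M"
    unfolding f_def by measurable
  define a where "a x = (\<integral>\<^sup>+y\<in>B x r. f y \<partial>M) / emeasure M (B x r)" for x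
  have "(\<lambda>x. \<integral>\<^sup>+y. f y * indicator {(x, y) \<in> space M \<times> space M. \<rho> x y < r} (x, y) \<partial>M) \<in> borel_measurable M"
    by measurable
  also have "?this \<longleftrightarrow> (\<lambda>x. \<integral>\<^sup>+y\<in>B x r. f y \<partial>M) \<in> borel_measurable M"
    by (intro measurable_cong nn_integral_cong) (auto simp: qball_def split: split_indicator)
  finally have a[measurable]: "a \<in> borel_measurable M"
    unfolding a_def by measurable
  have pt: "ennreal (\<bar>u x\<bar> powr p) \<le> k * (H x + a x)" if x: "x \<in> space M" for x
  proof -
    note [measurable] = ball_sets[OF x]
    let ?m = "emeasure M (B x r)"
    have m: "?m \<noteq> 0" "?m \<noteq> top"
      using ball_pos[OF x r] ball_finite[OF x r] by auto
    have "ennreal (\<bar>u x\<bar> powr p) * ?m = (\<integral>\<^sup>+y\<in>B x r. ennreal (\<bar>u x\<bar> powr p) \<partial>M)"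
      by (simp add: nn_integral_cmult_indicator)
    also have "\<dots> \<le> (\<integral>\<^sup>+y. k * (H x * indicator (B x r) y + f y * indicator (B x r) y) \<partial>M)"
    proof (rule nn_integral_mono)
      fix y assume y: "y \<in> space M"
      have "ennreal (\<bar>u x\<bar> powr p) \<le> k * (H x + f y)" if "y \<in> B x r"
      proof -
        have "ennreal (\<bar>u x\<bar> powr p) \<le> k * (ennreal (\<bar>u y\<bar> powr p) + ennreal (\<bar>u x - u y\<bar> powr p))"
          using ennreal_abs_add_powr_le[OF p, of "u y" "u x - u y"] by (simp add: k_def)
        also have "\<dots> \<le> k * (ennreal (\<bar>u y\<bar> powr p) + (H x + H y))"
          using that x y by (intro mult_left_mono add_left_mono osc) (auto simp: qball_def)
        finally show ?thesis by (simp add: f_def add_ac)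
      qed
      then show "ennreal (\<bar>u x\<bar> powr p) * indicator (B x r) y
          \<le> k * (H x * indicator (B x r) y + f y * indicator (B x r) y)"
        by (auto split: split_indicator)
    qed
    also have "\<dots> = k * (H x * ?m + (\<integral>\<^sup>+y\<in>B x r. f y \<partial>M))"
      by (simp add: nn_integral_add nn_integral_cmult)
    also have "(\<integral>\<^sup>+y\<in>B x r. f y \<partial>M) = a x * ?m"
      using m by (simp add: a_def ennreal_divide_times less_top)
    also have "k * (H x * ?m + a x * ?m) = k * (H x + a x) * ?m"
      by (simp add: distrib_right mult.assoc)
    finally show ?thesis
      using m by (simp add: ennreal_mult_le_mult_iff mult.commute[of _ ?m])
  qed
  have "(\<integral>\<^sup>+x\<in>A. ennreal (\<bar>u x\<bar> powr p) \<partial>N) \<le> (\<integral>\<^sup>+x. k * (H x + a x * indicator A x) \<partial>N)"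
    using pt by (intro nn_integral_mono) (auto simp: space_N split: split_indicator)
  also have "\<dots> = k * ((\<integral>\<^sup>+x. H x \<partial>N) + (\<integral>\<^sup>+x\<in>A. a x \<partial>N))"
    by (simp add: nn_integral_add nn_integral_cmult)
  also have "\<dots> \<le> k * (ennreal C * (\<integral>\<^sup>+x. H x \<partial>M) + (\<integral>\<^sup>+y. f y * t \<partial>M))"
    unfolding a_def nn_integral_ball_average[OF f \<open>A \<in> sets M\<close> r] using mass
    by (intro mult_left_mono add_mono nn_integral_le_dominated nn_integral_mono sets_N dominated) auto
  also have "(\<integral>\<^sup>+y. f y * t \<partial>M) = ((\<integral>\<^sup>+x. ennreal (\<bar>u x\<bar> powr p) \<partial>M) + (\<integral>\<^sup>+x. H x \<partial>M)) * t"
    unfolding f_def by (simp add: nn_integral_multc nn_integral_add)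
  finally show ?thesis by (simp add: k_def)
qed

end

section \<open>Total boundedness from vanishing oscillation\<close>

lemma exists_finite_subcover_up_to_measure:
  assumes A: "A \<in> sets N" "emeasure N A < \<infinity>" and U: "\<And>i::nat. U i \<in> sets N"
    and cover: "A \<subseteq> (\<Union>i. U i)" and "\<delta> > 0"
  shows "\<exists>n. emeasure N (A - (\<Union>i<n. U i)) < \<delta>"
proof -
  have "(\<lambda>n. emeasure N (A - (\<Union>i<n. U i))) \<longlonglongrightarrow> emeasure N (\<Inter>n. A - (\<Union>i<n. U i))"
  proof (rule Lim_emeasure_decseq)
    show "range (\<lambda>n. A - (\<Union>i<n. U i)) \<subseteq> sets N"
      using A U by auto
    show "decseq (\<lambda>n. A - (\<Union>i<n. U i))"
      by (rule monotoneI) (auto dest: less_le_trans)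
    show "emeasure N (A - (\<Union>i<n. U i)) \<noteq> \<infinity>" for n
      using emeasure_mono[of "A - (\<Union>i<n. U i)" A N] A by (auto simp: top_unique)
  qed
  also have "(\<Inter>n. A - (\<Union>i<n. U i)) = {}"
    using cover by (auto dest: subsetD)
  finally have "(\<lambda>n. emeasure N (A - (\<Union>i<n. U i))) \<longlonglongrightarrow> 0"
    by simp
  then have "eventually (\<lambda>n. emeasure N (A - (\<Union>i<n. U i)) < \<delta>) sequentially"
    using \<open>\<delta> > 0\<close> by (rule order_tendstoD)
  then show ?thesis
    by (rule eventually_happens'[rotated]) simp
qed

lemma emeasure_superlevel_le:
  assumes [measurable]: "f \<in> borel_measurable M" and a: "a > (0::real)"
    and I: "(\<integral>\<^sup>+x. f x \<partial>M) \<le> ennreal (a * b)"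
  shows "emeasure M {x\<in>space M. f x > ennreal a} \<le> ennreal b"
proof -
  have "ennreal a * emeasure M {x\<in>space M. f x > ennreal a}
      = (\<integral>\<^sup>+x. ennreal a * indicator {x\<in>space M. f x > ennreal a} x \<partial>M)"
    by (simp add: nn_integral_cmult_indicator)
  also have "\<dots> \<le> (\<integral>\<^sup>+x. f x \<partial>M)"
    by (intro nn_integral_mono) (auto split: split_indicator)
  also have "\<dots> \<le> ennreal a * ennreal b"
    using I a by (simp add: ennreal_mult')
  finally show ?thesis
    using a by (simp add: ennreal_mult_le_mult_iff)
qed

context dominated_quasi_metric_measure
begin

text \<open>
  A nonlinear substitute for a uniform modulus of continuity: at small distances the oscillation
  of every \<open>u \<in> S\<close> is dominated by a function \<open>H\<close> of small integral, which may depend on \<open>u\<close>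
  and on \<open>\<epsilon>\<close>, while the distance \<open>r\<close> depends on \<open>\<epsilon>\<close> only. As \<open>H\<close> may be infinite,
  exceptional null sets can be absorbed into it.
\<close>

definition vanishing_oscillation :: "real \<Rightarrow> ('a \<Rightarrow> real) set \<Rightarrow> bool" where
  "vanishing_oscillation p S \<longleftrightarrow>
     (\<forall>\<epsilon>>0. \<exists>r>0. \<forall>u\<in>S. \<exists>H\<in>borel_measurable M. (\<integral>\<^sup>+x. H x \<partial>M) \<le> ennreal \<epsilon> \<and>
        (\<forall>x\<in>space M. \<forall>y\<in>space M. \<rho> x y < r \<longrightarrow> ennreal (\<bar>u x - u y\<bar> powr p) \<le> H x + H y))"

lemma vanishing_oscillationE:
  assumes "vanishing_oscillation p S" "\<epsilon> > 0"
  obtains r H where "r > 0"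
    "\<And>u. u \<in> S \<Longrightarrow> H u \<in> borel_measurable M"
    "\<And>u. u \<in> S \<Longrightarrow> (\<integral>\<^sup>+x. H u x \<partial>M) \<le> ennreal \<epsilon>"
    "\<And>u x y. u \<in> S \<Longrightarrow> x \<in> space M \<Longrightarrow> y \<in> space M \<Longrightarrow> \<rho> x y < r \<Longrightarrow>
      ennreal (\<bar>u x - u y\<bar> powr p) \<le> H u x + H u y"
  using assms unfolding vanishing_oscillation_def by metis

lemma averaging_mass_mono:
  "A \<subseteq> A' \<Longrightarrow> averaging_mass r A y \<le> averaging_mass r A' y"
  unfolding averaging_mass_def by (intro nn_integral_mono) (auto split: split_indicator)

lemma averaging_mass_Un_le:
  assumes "A \<in> sets M" "A' \<in> sets M" "y \<in> space M"
  shows "averaging_mass r (A \<union> A') y \<le> averaging_mass r A y + averaging_mass r A' y"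
proof -
  note [measurable] = measurable_emeasure_ball assms(1,2) ball_sets[OF assms(3)]
  note [measurable_cong] = sets_N
  have "averaging_mass r (A \<union> A') y \<le> (\<integral>\<^sup>+x. indicator (B y r) x / emeasure M (B x r) * indicator A x
      + indicator (B y r) x / emeasure M (B x r) * indicator A' x \<partial>N)"
    unfolding averaging_mass_def by (intro nn_integral_mono) (auto split: split_indicator)
  also have "\<dots> = averaging_mass r A y + averaging_mass r A' y"
    unfolding averaging_mass_def by (rule nn_integral_add) measurable
  finally show ?thesis .
qed

text \<open>
  If \<open>\<rho> x0 y < R\<close>, the ball of radius \<open>r\<close> around \<open>y\<close> stays in the ball of radius
  \<open>c max R r\<close> around \<open>x0\<close>, so the kernel vanishes outside the latter.
\<close>

lemma averaging_mass_far:
  assumes "x0 \<in> space M" "y \<in> B x0 R" "r > 0"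
  shows "averaging_mass r (space M - B x0 (c * max R r)) y = 0"
proof -
  have "x \<in> B x0 (c * max R r)" if "x \<in> B y r" for x
    using that assms less_scaled_triangle[of x0 x y "max R r"] by (auto simp: qball_def)
  then have "averaging_mass r (space M - B x0 (c * max R r)) y = (\<integral>\<^sup>+x. 0 \<partial>N)"
    unfolding averaging_mass_def by (intro nn_integral_cong) (auto split: split_indicator)
  then show ?thesis by simp
qed

definition uniformly_integrable_averaging :: "real \<Rightarrow> bool" where
  "uniformly_integrable_averaging r \<longleftrightarrow>
     (\<forall>\<epsilon>>0. \<exists>\<delta>>0. \<forall>A\<in>sets M. emeasure N A < ennreal \<delta> \<longrightarrow>
        (\<forall>y\<in>space M. averaging_mass r A y \<le> ennreal \<epsilon>))"

definition tight_averaging :: "'a \<Rightarrow> real \<Rightarrow> bool" where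
  "tight_averaging x0 r \<longleftrightarrow>
     (\<forall>\<epsilon>>0. \<exists>R>0. \<forall>y\<in>space M - B x0 R. averaging_mass r (space M) y \<le> ennreal \<epsilon>)"

text \<open>
  Splitting \<open>A\<close> along a large ball around \<open>x0\<close>: the inner part is handled by uniform
  integrability. For the outer part, centres \<open>y\<close> near \<open>x0\<close> do not see it, and for the remaining
  ones tightness applies.
\<close>

lemma averaging_mass_uniformly_small:
  assumes x0: "x0 \<in> space M" and r: "r > 0"
    and "uniformly_integrable_averaging r" "tight_averaging x0 r" and "\<epsilon> > 0"
  shows "\<exists>R>0. \<exists>\<delta>>0. \<forall>A\<in>sets M. emeasure N (A \<inter> B x0 R) < ennreal \<delta> \<longrightarrow>
    (\<forall>y\<in>space M. averaging_mass r A y \<le> ennreal \<epsilon>)"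
proof -
  have "\<epsilon> / 2 > 0" using \<open>\<epsilon> > 0\<close> by simp
  obtain R1 where R1: "R1 > 0" "\<And>y. y \<in> space M - B x0 R1 \<Longrightarrow> averaging_mass r (space M) y \<le> ennreal (\<epsilon> / 2)"
    using assms(4) \<open>\<epsilon> / 2 > 0\<close> unfolding tight_averaging_def by metis
  obtain \<delta> where \<delta>: "\<delta> > 0" "\<And>A y. A \<in> sets M \<Longrightarrow> emeasure N A < ennreal \<delta> \<Longrightarrow> y \<in> space M \<Longrightarrow>
      averaging_mass r A y \<le> ennreal (\<epsilon> / 2)"
    using assms(3) \<open>\<epsilon> / 2 > 0\<close> unfolding uniformly_integrable_averaging_def by metis
  define R where "R = c * max R1 r"
  have "R > 0" using R1 c_ge_1 by (simp add: R_def)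
  moreover have "averaging_mass r A y \<le> ennreal \<epsilon>"
    if A: "A \<in> sets M" "emeasure N (A \<inter> B x0 R) < ennreal \<delta>" and y: "y \<in> space M" for A y
  proof -
    have far: "averaging_mass r (space M - B x0 R) y \<le> ennreal (\<epsilon> / 2)"
    proof (cases "y \<in> B x0 R1")
      case True
      then show ?thesis
        using averaging_mass_far[OF x0 True r] by (simp add: R_def)
    next
      case False
      with R1(2)[of y] y show ?thesis
        using averaging_mass_mono[of "space M - B x0 R" "space M" r y] by auto
    qed
    have "averaging_mass r A y \<le> averaging_mass r ((A \<inter> B x0 R) \<union> (space M - B x0 R)) y"
      using sets.sets_into_space[OF A(1)] by (intro averaging_mass_mono) auto
    also have "\<dots> \<le> averaging_mass r (A \<inter> B x0 R) y + averaging_mass r (space M - B x0 R) y"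
      using A(1) y ball_sets[OF x0] by (intro averaging_mass_Un_le) auto
    also have "\<dots> \<le> ennreal (\<epsilon> / 2) + ennreal (\<epsilon> / 2)"
      using A y ball_sets[OF x0] by (intro add_mono \<delta>(2) far) auto
    also have "\<dots> = ennreal \<epsilon>"
      using \<open>\<epsilon> > 0\<close> by (simp flip: ennreal_plus)
    finally show ?thesis .
  qed
  ultimately show ?thesis using \<delta>(1) by blast
qed

text \<open>
  The oscillation term is made small first, which fixes the radius \<open>r\<close>; for this \<open>r\<close> the
  averaging mass is then made small by the choice of \<open>R\<close> and \<open>\<delta>\<close>. The constants \<open>\<eta>\<close> and
  \<open>t\<close> are such that the two terms contribute \<open>\<epsilon> / 2\<close> each.
\<close>

lemma powr_uniformly_integrable:
  assumes p: "p > 0" and S: "S \<subseteq> borel_measurable M" and x0: "x0 \<in> space M"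
    and K: "K \<ge> 0" "\<And>u. u \<in> S \<Longrightarrow> (\<integral>\<^sup>+x. ennreal (\<bar>u x\<bar> powr p) \<partial>M) \<le> ennreal K"
    and osc: "vanishing_oscillation p S"
    and avg: "r0 > 0" "\<And>r. 0 < r \<Longrightarrow> r \<le> r0 \<Longrightarrow> uniformly_integrable_averaging r"
      "\<And>r. 0 < r \<Longrightarrow> r \<le> r0 \<Longrightarrow> tight_averaging x0 r"
    and "\<epsilon> > 0"
  shows "\<exists>R>0. \<exists>\<delta>>0. \<forall>A\<in>sets M. emeasure N (A \<inter> B x0 R) < ennreal \<delta> \<longrightarrow>
    (\<forall>u\<in>S. (\<integral>\<^sup>+x\<in>A. ennreal (\<bar>u x\<bar> powr p) \<partial>N) \<le> ennreal \<epsilon>)"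
proof -
  define \<eta> where "\<eta> = \<epsilon> / (2 * 2 powr p * C)"
  define t where "t = \<epsilon> / (2 * 2 powr p * (K + \<eta>))"
  have pos: "\<eta> > 0" "t > 0"
    using \<open>\<epsilon> > 0\<close> C_pos K by (auto simp: \<eta>_def t_def intro!: divide_pos_pos mult_pos_pos add_nonneg_pos)
  have total: "2 powr p * (C * \<eta> + (K + \<eta>) * t) = \<epsilon>"
  proof -
    have "K + \<eta> > 0" using pos K by linarith
    then have "2 powr p * (C * \<eta>) = \<epsilon> / 2" "2 powr p * ((K + \<eta>) * t) = \<epsilon> / 2"
      using C_pos by (simp_all add: t_def) (simp add: \<eta>_def)
    then show ?thesis by (simp add: distrib_left)
  qed
  obtain r1 H where H: "r1 > 0"
    "\<And>u. u \<in> S \<Longrightarrow> H u \<in> borel_measurable M"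
    "\<And>u. u \<in> S \<Longrightarrow> (\<integral>\<^sup>+x. H u x \<partial>M) \<le> ennreal \<eta>"
    "\<And>u x y. u \<in> S \<Longrightarrow> x \<in> space M \<Longrightarrow> y \<in> space M \<Longrightarrow> \<rho> x y < r1 \<Longrightarrow>
      ennreal (\<bar>u x - u y\<bar> powr p) \<le> H u x + H u y"
    using vanishing_oscillationE[OF osc pos(1)] by metis
  define r where "r = min r0 r1"
  have r: "0 < r" "r \<le> r0" "r \<le> r1"
    using avg(1) H(1) by (auto simp: r_def)
  obtain R \<delta> where R: "R > 0" "\<delta> > 0"
    "\<And>A y. A \<in> sets M \<Longrightarrow> emeasure N (A \<inter> B x0 R) < ennreal \<delta> \<Longrightarrow> y \<in> space M \<Longrightarrow>
      averaging_mass r A y \<le> ennreal t"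
    using averaging_mass_uniformly_small[OF x0 r(1) avg(2,3)[OF r(1,2)] pos(2)] by metis
  have "(\<integral>\<^sup>+x\<in>A. ennreal (\<bar>u x\<bar> powr p) \<partial>N) \<le> ennreal \<epsilon>"
    if A: "A \<in> sets M" "emeasure N (A \<inter> B x0 R) < ennreal \<delta>" and u: "u \<in> S" for A u
  proof -
    have "(\<integral>\<^sup>+x\<in>A. ennreal (\<bar>u x\<bar> powr p) \<partial>N)
      \<le> ennreal (2 powr p) * (ennreal C * (\<integral>\<^sup>+x. H u x \<partial>M)
        + ((\<integral>\<^sup>+x. ennreal (\<bar>u x\<bar> powr p) \<partial>M) + (\<integral>\<^sup>+x. H u x \<partial>M)) * ennreal t)"
      using u S H(2)[OF u] A r H(4)[OF u] R(3)[OF A] by (intro set_nn_integral_powr_le[OF p r(1)]) auto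
    also have "\<dots> \<le> ennreal (2 powr p) * (ennreal C * ennreal \<eta> + (ennreal K + ennreal \<eta>) * ennreal t)"
      using u by (intro mult_left_mono add_mono mult_right_mono K H) auto
    also have "\<dots> = ennreal (2 powr p * (C * \<eta> + (K + \<eta>) * t))"
      using pos K C_pos by (simp add: ennreal_mult ennreal_plus)
    finally show ?thesis by (simp add: total)
  qed
  with R(1,2) show ?thesis by blast
qed

text \<open>
  By Markov's inequality, off a set of small measure \<open>u\<close> is bounded by a fixed constant and
  oscillates by at most \<open>\<theta> / 2\<close> on each ball of a fixed small radius. Up to small measure,
  \<open>A\<close> is covered by finitely many such balls. The label of \<open>u\<close> records which values, rounded
  to the grid of width \<open>\<theta> / 2\<close>, the good part of \<open>u\<close> attains on which ball: finitely many
  patterns are possible. If \<open>u\<close> and \<open>v\<close> have the same label and \<open>x\<close> is good for both, then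
  \<open>u x\<close> and some value \<open>v y\<close> in the same ball round to the same grid point, and \<open>v y\<close> is
  within \<open>\<theta> / 2\<close> of \<open>v x\<close>.
\<close>

lemma totally_bounded_in_measure:
  assumes p: "p > 0" and S: "S \<subseteq> borel_measurable M"
    and K: "K \<ge> 0" "\<And>u. u \<in> S \<Longrightarrow> (\<integral>\<^sup>+x. ennreal (\<bar>u x\<bar> powr p) \<partial>M) \<le> ennreal K"
    and osc: "vanishing_oscillation p S"
    and A: "A \<in> sets M" "emeasure N A < \<infinity>" and \<delta>: "\<delta> > 0" and \<theta>: "\<theta> > 0"
  shows "\<exists>P :: ('a \<Rightarrow> real) \<Rightarrow> (nat \<times> int) set. finite (P ` S) \<and>
    (\<forall>u\<in>S. \<forall>v\<in>S. P u = P v \<longrightarrow> emeasure N {x\<in>A. \<bar>u x - v x\<bar> > \<theta>} < ennreal \<delta>)"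
proof (cases "space M = {}")
  case True
  then have "A = {}"
    using sets.sets_into_space[OF A(1)] by auto
  then show ?thesis
    using \<delta> by (intro exI[of _ "\<lambda>_. {}"]) (simp add: image_constant_conv)
next
  case False
  \<comment> \<open>The measure lost is \<open>\<delta> / 6\<close> to the part of \<open>A\<close> left uncovered, and \<open>C (2 \<beta>) = \<delta> / 3\<close> to
    each of the sets where \<open>u\<close> and \<open>v\<close> are not good; \<open>H u \<le> \<eta>\<close> gives oscillation
    \<open>\<theta> / 2\<close>.\<close>
  define \<eta> where "\<eta> = (\<theta> / 2) powr p / 2"
  define \<beta> where "\<beta> = \<delta> / (6 * C)"
  define l where "l = (K + 1) / \<beta>"
  have pos: "\<eta> > 0" "\<beta> > 0" "l > 0"
    using \<theta> \<delta> C_pos K by (auto simp: \<eta>_def \<beta>_def l_def)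
  obtain r H where H: "r > 0"
    "\<And>u. u \<in> S \<Longrightarrow> H u \<in> borel_measurable M"
    "\<And>u. u \<in> S \<Longrightarrow> (\<integral>\<^sup>+x. H u x \<partial>M) \<le> ennreal (\<eta> * \<beta>)"
    "\<And>u x y. u \<in> S \<Longrightarrow> x \<in> space M \<Longrightarrow> y \<in> space M \<Longrightarrow> \<rho> x y < r \<Longrightarrow>
      ennreal (\<bar>u x - u y\<bar> powr p) \<le> H u x + H u y"
    using vanishing_oscillationE[OF osc mult_pos_pos[OF pos(1,2)]] by metis
  have "r / c > 0" using H(1) c_ge_1 by simp
  then obtain D where D: "countable D" "D \<subseteq> space M" "space M = (\<Union>z\<in>D. B z (r / c))"
    using countable_net by blast
  have "D \<noteq> {}" using D(3) False by auto
  define z where "z = from_nat_into D"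
  have z: "range z = D"
    using range_from_nat_into[OF \<open>D \<noteq> {}\<close> D(1)] by (simp add: z_def)
  define U where "U i = B (z i) (r / c)" for i
  have U: "U i \<in> sets M" for i
    unfolding U_def using z D(2) by (intro ball_sets) auto
  have U_close: "\<rho> x y < r" if "x \<in> U i" "y \<in> U i" for x y i
  proof -
    have sp: "x \<in> space M" "y \<in> space M" "z i \<in> space M"
      using that z D(2) by (auto simp: U_def qball_def)
    have "\<rho> x y < c * (r / c)"
      using that by (intro less_scaled_triangle[OF sp]) (auto simp: U_def qball_def commute[OF sp(1,3)])
    then show ?thesis using c_ge_1 by simp
  qed
  have "A \<subseteq> (\<Union>i. U i)"
    using sets.sets_into_space[OF A(1)] D(3) z by (auto simp: U_def)
  then obtain n where n: "emeasure N (A - (\<Union>i<n. U i)) < ennreal (\<delta> / 6)"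
    using exists_finite_subcover_up_to_measure[of A N U "ennreal (\<delta> / 6)"] A U \<delta> by (auto simp: sets_N)
  define G where "G u = {x\<in>space M. H u x \<le> ennreal \<eta> \<and> ennreal (\<bar>u x\<bar> powr p) \<le> ennreal l}" for u
  define P where "P u = {(i, j). i < n \<and> (\<exists>x\<in>U i \<inter> G u. \<lfloor>u x / (\<theta> / 2)\<rfloor> = j)}" for u
  define J where "J = \<lceil>l powr (1 / p) / (\<theta> / 2)\<rceil> + 1"
  have osc_G: "\<bar>u x - u y\<bar> \<le> \<theta> / 2" if "u \<in> S" "x \<in> U i \<inter> G u" "y \<in> U i \<inter> G u" for u x y i
  proof (rule ccontr)
    assume *: "\<not> \<bar>u x - u y\<bar> \<le> \<theta> / 2"
    have "ennreal (\<bar>u x - u y\<bar> powr p) \<le> H u x + H u y"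
      using that U_close[of x i y] by (intro H(4)) (auto simp: G_def)
    also have "\<dots> \<le> ennreal \<eta> + ennreal \<eta>"
      using that by (intro add_mono) (auto simp: G_def)
    also have "\<dots> = ennreal ((\<theta> / 2) powr p)"
      using pos by (simp add: \<eta>_def flip: ennreal_plus)
    finally have "\<bar>u x - u y\<bar> powr p \<le> (\<theta> / 2) powr p"
      by simp
    moreover have "(\<theta> / 2) powr p < \<bar>u x - u y\<bar> powr p"
      using * \<theta> p by (intro powr_less_mono2) auto
    ultimately show False by simp
  qed
  have "P u \<subseteq> {..<n} \<times> {-J..J}" for u
  proof
    fix a assume "a \<in> P u"
    then obtain i x where a: "a = (i, \<lfloor>u x / (\<theta> / 2)\<rfloor>)" "i < n" "x \<in> G u"
      by (auto simp: P_def)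
    have "\<bar>u x\<bar> powr p \<le> l"
      using a(3) pos by (auto simp: G_def)
    then have "(\<bar>u x\<bar> powr p) powr (1 / p) \<le> l powr (1 / p)"
      using p by (intro powr_mono2) auto
    then have "\<bar>u x\<bar> \<le> l powr (1 / p)"
      using p by (simp add: powr_powr)
    then have "\<bar>u x / (\<theta> / 2)\<bar> \<le> l powr (1 / p) / (\<theta> / 2)"
      using \<theta> by (simp add: divide_right_mono)
    then have "\<lfloor>u x / (\<theta> / 2)\<rfloor> \<in> {-J..J}"
      unfolding J_def atLeastAtMost_iff by linarith
    with a show "a \<in> {..<n} \<times> {-J..J}" by simp
  qed
  then have "P ` S \<subseteq> Pow ({..<n} \<times> {-J..J})" by auto
  then have fin: "finite (P ` S)"
    by (rule finite_subset) simp
  have M_bad: "emeasure N (space M - G u) \<le> ennreal (\<delta> / 3)" if u: "u \<in> S" for u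
  proof -
    have [measurable]: "u \<in> borel_measurable M" "H u \<in> borel_measurable M"
      using u S H(2) by auto
    let ?E1 = "{x\<in>space M. H u x > ennreal \<eta>}"
    let ?E2 = "{x\<in>space M. ennreal (\<bar>u x\<bar> powr p) > ennreal l}"
    have E: "?E1 \<in> sets M" "?E2 \<in> sets M" by measurable
    have "emeasure M ?E1 \<le> ennreal \<beta>"
      using H(3)[OF u] pos by (intro emeasure_superlevel_le) auto
    moreover have "emeasure M ?E2 \<le> ennreal \<beta>"
    proof (rule emeasure_superlevel_le)
      have "ennreal K \<le> ennreal (l * \<beta>)"
        using pos by (intro ennreal_leI) (simp add: l_def)
      with K(2)[OF u] show "(\<integral>\<^sup>+x. ennreal (\<bar>u x\<bar> powr p) \<partial>M) \<le> ennreal (l * \<beta>)"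
        by (rule order_trans)
    qed (use pos in auto)
    ultimately have "emeasure M (?E1 \<union> ?E2) \<le> ennreal \<beta> + ennreal \<beta>"
      using emeasure_subadditive[OF E] by (auto intro: order_trans add_mono)
    moreover have bad: "space M - G u = ?E1 \<union> ?E2"
      by (auto simp: G_def not_le)
    ultimately have "emeasure M (space M - G u) \<le> ennreal \<beta> + ennreal \<beta>"
      by simp
    then have "ennreal C * emeasure M (space M - G u) \<le> ennreal C * (ennreal \<beta> + ennreal \<beta>)"
      by (rule mult_left_mono) simp
    also have "\<dots> = ennreal (\<delta> / 3)"
      using pos C_pos by (simp add: \<beta>_def flip: ennreal_plus ennreal_mult)
    finally show ?thesis
      using dominated[of "space M - G u"] sets.Un[OF E] unfolding bad by (auto intro: order_trans)
  qed
  have "emeasure N {x\<in>A. \<bar>u x - v x\<bar> > \<theta>} < ennreal \<delta>"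
    if uv: "u \<in> S" "v \<in> S" "P u = P v" for u v
  proof -
    have [measurable]: "u \<in> borel_measurable M" "H u \<in> borel_measurable M"
      "v \<in> borel_measurable M" "H v \<in> borel_measurable M" "A \<in> sets M"
      using uv S H(2) A by auto
    have sets: "A - (\<Union>i<n. U i) \<in> sets N" "space M - G u \<in> sets N" "space M - G v \<in> sets N"
      unfolding sets_N G_def using U by auto
    have "\<bar>u x - v x\<bar> \<le> \<theta>" if x: "x \<in> U i" "i < n" "x \<in> G u" "x \<in> G v" for x i
    proof -
      have "(i, \<lfloor>u x / (\<theta> / 2)\<rfloor>) \<in> P v"
        unfolding uv(3)[symmetric] using x by (auto simp: P_def)
      then obtain y where y: "y \<in> U i \<inter> G v" "\<lfloor>v y / (\<theta> / 2)\<rfloor> = \<lfloor>u x / (\<theta> / 2)\<rfloor>"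
        by (auto simp: P_def)
      then have "\<bar>u x / (\<theta> / 2) - v y / (\<theta> / 2)\<bar> < 1"
        by linarith
      then have "\<bar>u x * 2 - v y * 2\<bar> < \<theta>"
        using \<theta> by (simp add: field_simps flip: diff_divide_distrib)
      then have "\<bar>u x - v y\<bar> < \<theta> / 2"
        by linarith
      moreover have "\<bar>v y - v x\<bar> \<le> \<theta> / 2"
        using osc_G[OF uv(2) y(1)] x by auto
      ultimately show ?thesis by linarith
    qed
    then have "{x\<in>A. \<bar>u x - v x\<bar> > \<theta>} \<subseteq> (A - (\<Union>i<n. U i)) \<union> ((space M - G u) \<union> (space M - G v))"
      using sets.sets_into_space[OF A(1)] by (force simp: not_le)
    then have "emeasure N {x\<in>A. \<bar>u x - v x\<bar> > \<theta>}
        \<le> emeasure N ((A - (\<Union>i<n. U i)) \<union> ((space M - G u) \<union> (space M - G v)))"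
      using sets by (intro emeasure_mono) auto
    also have "\<dots> \<le> emeasure N (A - (\<Union>i<n. U i)) + emeasure N ((space M - G u) \<union> (space M - G v))"
      using sets by (intro emeasure_subadditive) auto
    also have "\<dots> \<le> emeasure N (A - (\<Union>i<n. U i)) + (emeasure N (space M - G u) + emeasure N (space M - G v))"
      using sets by (intro add_left_mono emeasure_subadditive) auto
    also have "\<dots> \<le> ennreal (\<delta> / 6) + (ennreal (\<delta> / 3) + ennreal (\<delta> / 3))"
      using n uv by (intro add_mono M_bad) auto
    also have "\<dots> = ennreal (5 * \<delta> / 6)"
      using \<delta> by (simp flip: ennreal_plus)
    also have "\<dots> < ennreal \<delta>"
      using \<delta> by (intro ennreal_lessI) auto
    finally show ?thesis .
  qed
  with fin show ?thesis by blast
qed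

theorem norm_totally_bounded_if_vanishing_oscillation:
  assumes p: "p > 0" and S: "S \<subseteq> borel_measurable M" and x0: "x0 \<in> space M"
    and K: "K \<ge> 0" "\<And>u. u \<in> S \<Longrightarrow> (\<integral>\<^sup>+x. ennreal (\<bar>u x\<bar> powr p) \<partial>M) \<le> ennreal K"
    and osc: "vanishing_oscillation p S"
    and avg: "r0 > 0" "\<And>r. 0 < r \<Longrightarrow> r \<le> r0 \<Longrightarrow> uniformly_integrable_averaging r"
      "\<And>r. 0 < r \<Longrightarrow> r \<le> r0 \<Longrightarrow> tight_averaging x0 r"
  shows "norm_totally_bounded (Lp_fun_norm N p) S"
proof (rule Lp_totally_boundedI[OF p])
  show "S \<subseteq> borel_measurable N"
    using S by (simp add: measurable_N)
next
  fix \<epsilon> :: real assume "\<epsilon> > 0"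
  from powr_uniformly_integrable[OF p S x0 K osc avg this]
  obtain R \<delta> where R: "R > 0" "\<delta> > 0" "\<forall>A\<in>sets M. emeasure N (A \<inter> B x0 R) < ennreal \<delta> \<longrightarrow>
    (\<forall>u\<in>S. (\<integral>\<^sup>+x\<in>A. ennreal (\<bar>u x\<bar> powr p) \<partial>N) \<le> ennreal \<epsilon>)"
    by auto
  moreover have "emeasure N (B x0 R) < \<infinity>"
    by (intro emeasure_N_finite ball_sets ball_finite x0 R)
  ultimately show "\<exists>B\<in>sets N. \<exists>\<delta>>0. emeasure N B < \<infinity> \<and>
      (\<forall>A\<in>sets N. emeasure N (A \<inter> B) < ennreal \<delta> \<longrightarrow>
        (\<forall>u\<in>S. (\<integral>\<^sup>+x\<in>A. ennreal (\<bar>u x\<bar> powr p) \<partial>N) \<le> ennreal \<epsilon>))"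
    using ball_sets[OF x0, of R] by (auto simp: sets_N)
next
  fix A :: "'a set" and \<delta> \<theta> :: real
  assume "A \<in> sets N" "emeasure N A < \<infinity>" "\<delta> > 0" "\<theta> > 0"
  then show "\<exists>P :: ('a \<Rightarrow> real) \<Rightarrow> (nat \<times> int) set. finite (P ` S) \<and>
    (\<forall>u\<in>S. \<forall>v\<in>S. P u = P v \<longrightarrow> emeasure N {x\<in>A. \<bar>u x - v x\<bar> > \<theta>} < ennreal \<delta>)"
    using totally_bounded_in_measure[OF p S K osc] by (simp add: sets_N)
qed

end

section \<open>Fractional gradients and vanishing oscillation\<close>

lemma exists_dyadic_scale:
  fixes t :: real
  assumes "t > 0"
  shows "\<exists>k::int. 2 powi (- k - 1) \<le> t \<and> t < 2 powi (- k)"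
proof -
  define m where "m = \<lfloor>log 2 t\<rfloor>"
  have "2 powr m \<le> t" "t < 2 powr (m + 1)"
    using assms by (simp_all add: m_def powr_le_iff less_powr_iff)
  moreover have "2 powr m = (2::real) powi m" "2 powr (m + 1) = (2::real) powi (m + 1)"
    by (rule powr_real_of_int'; simp)+
  ultimately show ?thesis
    by (intro exI[of _ "- m - 1"]) (simp add: add.commute)
qed

text \<open>
  The infimum in the norm need not be attained; the bound \<open>K + 1\<close> leaves room for a gradient that
  comes close to it.
\<close>

lemma fractional_gradient_of_HTL_norm:
  assumes "p > 0" "q > 0" "K \<ge> 0" and HTL: "HTL_norm d \<mu> \<alpha> p q u \<le> ennreal K"
  shows "\<exists>g\<in>fractional_gradients d \<mu> \<alpha> u.
    \<forall>k. (\<integral>\<^sup>+x. ennreal (\<bar>g k x\<bar> powr p) \<partial>\<mu>) \<le> ennreal ((K + 1) powr p)"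
proof -
  have "(INF g\<in>fractional_gradients d \<mu> \<alpha> u. Lp_norm \<mu> p (\<lambda>x. lq_norm q (\<lambda>k. ennreal (g k x))))
      \<le> HTL_norm d \<mu> \<alpha> p q u"
    by (simp add: HTL_norm_def)
  also have "\<dots> < ennreal (K + 1)"
    using HTL \<open>K \<ge> 0\<close> by (auto intro: le_less_trans ennreal_lessI)
  finally obtain g where g: "g \<in> fractional_gradients d \<mu> \<alpha> u"
    "Lp_norm \<mu> p (\<lambda>x. lq_norm q (\<lambda>k. ennreal (g k x))) < ennreal (K + 1)"
    by (auto simp: INF_less_iff)
  have "(\<integral>\<^sup>+x. ennreal (\<bar>g k x\<bar> powr p) \<partial>\<mu>) \<le> ennreal ((K + 1) powr p)" for k
  proof -
    have "(\<integral>\<^sup>+x. ennreal (\<bar>g k x\<bar> powr p) \<partial>\<mu>)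
        \<le> (\<integral>\<^sup>+x. ennreal_powr (lq_norm q (\<lambda>k. ennreal (g k x))) p \<partial>\<mu>)"
    proof (rule nn_integral_mono)
      fix x assume "x \<in> space \<mu>"
      then have "g k x \<ge> 0"
        using g(1) by (simp add: fractional_gradients_def)
      then have "ennreal (\<bar>g k x\<bar> powr p) = ennreal_powr (ennreal (g k x)) p"
        by (simp add: ennreal_powr_ennreal)
      also have "\<dots> \<le> ennreal_powr (lq_norm q (\<lambda>k. ennreal (g k x))) p"
        using \<open>p > 0\<close> le_lq_norm[OF \<open>q > 0\<close>, of "\<lambda>k. ennreal (g k x)" k]
        by (intro ennreal_powr_mono) auto
      finally show "ennreal (\<bar>g k x\<bar> powr p) \<le> ennreal_powr (lq_norm q (\<lambda>k. ennreal (g k x))) p" .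
    qed
    also have "\<dots> \<le> ennreal ((K + 1) powr p)"
      using g(2) assms by (intro Lp_norm_leD) auto
    finally show ?thesis .
  qed
  with g(1) show ?thesis by blast
qed

lemma fractional_gradient_of_HB_norm:
  assumes "p > 0" "q > 0" "K \<ge> 0" and HB: "HB_norm d \<mu> \<alpha> p q u \<le> ennreal K"
  shows "\<exists>g\<in>fractional_gradients d \<mu> \<alpha> u.
    \<forall>k. (\<integral>\<^sup>+x. ennreal (\<bar>g k x\<bar> powr p) \<partial>\<mu>) \<le> ennreal ((K + 1) powr p)"
proof -
  have "(INF g\<in>fractional_gradients d \<mu> \<alpha> u. lq_norm q (\<lambda>k. Lp_fun_norm \<mu> p (g k)))
      \<le> HB_norm d \<mu> \<alpha> p q u"
    by (simp add: HB_norm_def)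
  also have "\<dots> < ennreal (K + 1)"
    using HB \<open>K \<ge> 0\<close> by (auto intro: le_less_trans ennreal_lessI)
  finally obtain g where g: "g \<in> fractional_gradients d \<mu> \<alpha> u"
    "lq_norm q (\<lambda>k. Lp_fun_norm \<mu> p (g k)) < ennreal (K + 1)"
    by (auto simp: INF_less_iff)
  have "(\<integral>\<^sup>+x. ennreal (\<bar>g k x\<bar> powr p) \<partial>\<mu>) \<le> ennreal ((K + 1) powr p)" for k
    using g(2) assms le_lq_norm[OF \<open>q > 0\<close>, of "\<lambda>k. Lp_fun_norm \<mu> p (g k)" k]
    by (intro Lp_fun_norm_leD) auto
  with g(1) show ?thesis by blast
qed

text \<open>
  At distances below \<open>2 powi - n\<close> only the scales \<open>k \<ge> n\<close> occur, and at scale \<open>k\<close> the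
  \<open>p\<close>-th power of the oscillation is at most \<open>2\<^sup>p 2 powr - (k \<alpha> p)\<close> times the sum of
  \<open>g k x\<close> and \<open>g k y\<close> raised to the power \<open>p\<close>. Summing these majorants over all
  \<open>k \<ge> n\<close> gives one function \<open>H\<close> that works at every scale; its integral is a geometric tail
  because the integrals of the \<open>p\<close>-th powers of the \<open>g k\<close> are bounded uniformly in \<open>k\<close>.
\<close>

lemma oscillation_bound_of_fractional_gradient:
  fixes n :: nat
  assumes p: "p > 0" and \<alpha>: "\<alpha> > 0" and K: "K \<ge> 0"
    and g: "g \<in> fractional_gradients d \<mu> \<alpha> u"
      "\<And>k. (\<integral>\<^sup>+x. ennreal (\<bar>g k x\<bar> powr p) \<partial>\<mu>) \<le> ennreal K"
    and d_pos: "\<And>x y. x \<in> space \<mu> \<Longrightarrow> y \<in> space \<mu> \<Longrightarrow> x \<noteq> y \<Longrightarrow> d x y > 0"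
  shows "\<exists>H\<in>borel_measurable \<mu>.
    (\<integral>\<^sup>+x. H x \<partial>\<mu>) \<le> ennreal ((2 powr (- (\<alpha> * p))) ^ n * (2 powr p * K / (1 - 2 powr (- (\<alpha> * p))))) \<and>
    (\<forall>x\<in>space \<mu>. \<forall>y\<in>space \<mu>. d x y < 2 powi (- int n) \<longrightarrow> ennreal (\<bar>u x - u y\<bar> powr p) \<le> H x + H y)"
proof -
  define b where "b = 2 powr (- (\<alpha> * p))"
  have b: "0 < b" "b < 1"
    using \<alpha> p powr_less_mono[of "- (\<alpha> * p)" 0 "2::real"] by (auto simp: b_def)
  have g_meas[measurable]: "g k \<in> borel_measurable \<mu>" and g_nonneg: "x \<in> space \<mu> \<Longrightarrow> 0 \<le> g k x" for k x
    using g(1) by (auto simp: fractional_gradients_def)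
  obtain E where E: "E \<in> null_sets \<mu>"
    "\<And>k x y. x \<in> space \<mu> - E \<Longrightarrow> y \<in> space \<mu> - E \<Longrightarrow> 2 powi (- k - 1) \<le> d x y \<Longrightarrow> d x y < 2 powi (- k) \<Longrightarrow>
      \<bar>u x - u y\<bar> \<le> d x y powr \<alpha> * (g k x + g k y)"
    using g(1) unfolding fractional_gradients_def by blast
  have [measurable]: "E \<in> sets \<mu>" using E(1) by auto
  define G where "G i x = ennreal (2 powr p * b ^ (n + i)) * ennreal (\<bar>g (int (n + i)) x\<bar> powr p)" for i x
  have G_meas[measurable]: "G i \<in> borel_measurable \<mu>" for i
    unfolding G_def by measurable
  \<comment> \<open>The value \<open>\<infinity>\<close> on the null set \<open>E\<close> makes the estimate hold everywhere.\<close>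
  define H where "H x = (\<Sum>i. G i x) + \<infinity> * indicator E x" for x
  have "(\<integral>\<^sup>+x. H x \<partial>\<mu>) = (\<integral>\<^sup>+x. (\<Sum>i. G i x) \<partial>\<mu>) + (\<integral>\<^sup>+x. \<infinity> * indicator E x \<partial>\<mu>)"
    unfolding H_def by (rule nn_integral_add) measurable
  also have "\<dots> = (\<Sum>i. \<integral>\<^sup>+x. G i x \<partial>\<mu>)"
    using E(1) by (simp add: nn_integral_suminf nn_integral_cmult_indicator null_setsD1)
  also have "\<dots> \<le> (\<Sum>i. ennreal (2 powr p * b ^ n * K * b ^ i))"
  proof (intro suminf_le summableI)
    fix i
    have "(\<integral>\<^sup>+x. G i x \<partial>\<mu>) = ennreal (2 powr p * b ^ (n + i)) * (\<integral>\<^sup>+x. ennreal (\<bar>g (int (n + i)) x\<bar> powr p) \<partial>\<mu>)"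
      unfolding G_def by (rule nn_integral_cmult) measurable
    also have "\<dots> \<le> ennreal (2 powr p * b ^ (n + i)) * ennreal K"
      by (intro mult_left_mono g(2)) simp
    also have "\<dots> = ennreal (2 powr p * b ^ n * K * b ^ i)"
      using b K by (simp add: power_add mult_ac flip: ennreal_mult)
    finally show "(\<integral>\<^sup>+x. G i x \<partial>\<mu>) \<le> ennreal (2 powr p * b ^ n * K * b ^ i)" .
  qed
  also have "\<dots> = ennreal (2 powr p * b ^ n * K * (1 / (1 - b)))"
    using b K by (intro suminf_ennreal_eq sums_mult geometric_sums) auto
  finally have "(\<integral>\<^sup>+x. H x \<partial>\<mu>) \<le> ennreal (b ^ n * (2 powr p * K / (1 - b)))"
    by (simp add: mult_ac)
  moreover have "ennreal (\<bar>u x - u y\<bar> powr p) \<le> H x + H y"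
    if xy: "x \<in> space \<mu>" "y \<in> space \<mu>" "d x y < 2 powi (- int n)" for x y
  proof -
    consider "x = y" | "x \<in> E \<or> y \<in> E" | "x \<noteq> y" "x \<in> space \<mu> - E" "y \<in> space \<mu> - E"
      using xy by blast
    then show ?thesis
    proof cases
      case 3
      then obtain k :: int where k: "2 powi (- k - 1) \<le> d x y" "d x y < 2 powi (- k)"
        using exists_dyadic_scale d_pos by (meson DiffD1)
      have "(2::real) powi (- k - 1) < 2 powi (- int n)"
        using k(1) xy(3) by linarith
      then have "k \<ge> int n"
        using power_int_increasing[of "- int n" "- k - 1" "2::real"] by linarith
      then obtain i where i: "k = int (n + i)"
        by (metis zero_le_imp_eq_int le_iff_diff_le_0 nat_int of_nat_add zle_iff_zadd)
      have d_powr: "d x y powr \<alpha> \<le> (2 powi (- k)) powr \<alpha>"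
        using k \<alpha> d_pos[OF xy(1,2) 3(1)] by (intro powr_mono2) auto
      have "\<bar>u x - u y\<bar> \<le> d x y powr \<alpha> * (g k x + g k y)"
        using 3 k by (intro E(2)) auto
      also have "\<dots> \<le> (2 powi (- k)) powr \<alpha> * (g k x + g k y)"
        using d_powr g_nonneg xy by (intro mult_right_mono) (auto intro!: add_nonneg_nonneg)
      finally have "\<bar>u x - u y\<bar> powr p \<le> ((2 powi (- k)) powr \<alpha> * \<bar>g k x + g k y\<bar>) powr p"
        using p g_nonneg xy by (intro powr_mono2) auto
      also have "\<dots> = ((2 powi (- k)) powr \<alpha>) powr p * \<bar>g k x + g k y\<bar> powr p"
        by (simp add: powr_mult)
      also have "(2::real) powi (- k) = 2 powr (- real (n + i))"
        using powr_real_of_int'[of "2::real" "- k"] by (simp add: i)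
      also have "((2 powr (- real (n + i))) powr \<alpha>) powr p = b ^ (n + i)"
        using b powr_realpow[of b "n + i"] by (simp add: b_def powr_powr algebra_simps)
      also have "b ^ (n + i) * \<bar>g k x + g k y\<bar> powr p \<le> b ^ (n + i) * (2 powr p * (\<bar>g k x\<bar> powr p + \<bar>g k y\<bar> powr p))"
        using b by (intro mult_left_mono abs_add_powr_le p) auto
      finally have "ennreal (\<bar>u x - u y\<bar> powr p)
          \<le> ennreal (b ^ (n + i) * (2 powr p * (\<bar>g k x\<bar> powr p + \<bar>g k y\<bar> powr p)))"
        by (rule ennreal_leI)
      also have "\<dots> = G i x + G i y"
        using b by (simp add: G_def i distrib_left mult_ac flip: ennreal_mult ennreal_plus)
      also have "\<dots> \<le> H x + H y"
        unfolding H_def using sum_le_suminf[of "\<lambda>i. G i x" "{i}"] sum_le_suminf[of "\<lambda>i. G i y" "{i}"]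
        by (intro add_mono add_increasing2) auto
      finally show ?thesis .
    qed (use p in \<open>auto simp: H_def\<close>)
  qed
  ultimately show ?thesis
    using b_def by (intro bexI[of _ H]) (auto simp: H_def[abs_def])
qed

lemma quasi_metric_on_pos:
  assumes "quasi_metric_on X d" "x \<in> X" "y \<in> X" "x \<noteq> y"
  shows "d x y > 0"
  using assms unfolding quasi_metric_on_def by (metis order_le_less)

lemma (in dominated_quasi_metric_measure) vanishing_oscillation_of_fractional_gradients:
  assumes p: "p > 0" and \<alpha>: "\<alpha> > 0" and K: "K \<ge> 0"
    and d: "quasi_metric_on (space M) d" "quasi_metrics_equivalent (space M) d \<rho>"
    and g: "\<And>u. u \<in> S \<Longrightarrow> \<exists>g\<in>fractional_gradients d M \<alpha> u.
      \<forall>k. (\<integral>\<^sup>+x. ennreal (\<bar>g k x\<bar> powr p) \<partial>M) \<le> ennreal K"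
  shows "vanishing_oscillation p S"
  unfolding vanishing_oscillation_def
proof (intro allI impI)
  fix \<epsilon> :: real assume "\<epsilon> > 0"
  define b where "b = 2 powr (- (\<alpha> * p))"
  have b: "0 < b" "b < 1"
    using \<alpha> p powr_less_mono[of "- (\<alpha> * p)" 0 "2::real"] by (auto simp: b_def)
  have "(\<lambda>n. b ^ n * (2 powr p * K / (1 - b))) \<longlonglongrightarrow> 0"
    using b by (intro tendsto_mult_left_zero LIMSEQ_power_zero) auto
  then have "eventually (\<lambda>n. b ^ n * (2 powr p * K / (1 - b)) < \<epsilon>) sequentially"
    using \<open>\<epsilon> > 0\<close> by (rule order_tendstoD)
  then obtain n where n: "b ^ n * (2 powr p * K / (1 - b)) < \<epsilon>"
    using eventually_happens'[OF sequentially_bot] by blast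
  obtain \<kappa> where \<kappa>: "\<kappa> > 0" "\<And>x y. x \<in> space M \<Longrightarrow> y \<in> space M \<Longrightarrow> d x y \<le> \<kappa> * \<rho> x y"
    using d(2) unfolding quasi_metrics_equivalent_def by blast
  define r where "r = 2 powi (- int n) / \<kappa>"
  have r: "r > 0" using \<kappa> by (simp add: r_def)
  have close: "d x y < 2 powi (- int n)" if "x \<in> space M" "y \<in> space M" "\<rho> x y < r" for x y
  proof -
    have "\<kappa> * \<rho> x y < 2 powi (- int n)"
      using that(3) \<kappa>(1) by (simp add: r_def field_simps)
    with \<kappa>(2)[OF that(1,2)] show ?thesis by linarith
  qed
  have "\<exists>H\<in>borel_measurable M. (\<integral>\<^sup>+x. H x \<partial>M) \<le> ennreal \<epsilon> \<and>
      (\<forall>x\<in>space M. \<forall>y\<in>space M. \<rho> x y < r \<longrightarrow> ennreal (\<bar>u x - u y\<bar> powr p) \<le> H x + H y)" if u: "u \<in> S" for u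
  proof -
    obtain h where h: "h \<in> fractional_gradients d M \<alpha> u"
      "\<And>k. (\<integral>\<^sup>+x. ennreal (\<bar>h k x\<bar> powr p) \<partial>M) \<le> ennreal K"
      using g[OF u] by blast
    have "\<exists>H\<in>borel_measurable M.
        (\<integral>\<^sup>+x. H x \<partial>M) \<le> ennreal (b ^ n * (2 powr p * K / (1 - b))) \<and>
        (\<forall>x\<in>space M. \<forall>y\<in>space M. d x y < 2 powi (- int n) \<longrightarrow> ennreal (\<bar>u x - u y\<bar> powr p) \<le> H x + H y)"
      unfolding b_def
      by (rule oscillation_bound_of_fractional_gradient[OF p \<alpha> K h quasi_metric_on_pos[OF d(1)]])
    then obtain H where H: "H \<in> borel_measurable M"
        "(\<integral>\<^sup>+x. H x \<partial>M) \<le> ennreal (b ^ n * (2 powr p * K / (1 - b)))"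
        "\<And>x y. x \<in> space M \<Longrightarrow> y \<in> space M \<Longrightarrow> d x y < 2 powi (- int n) \<Longrightarrow>
          ennreal (\<bar>u x - u y\<bar> powr p) \<le> H x + H y"
      by blast
    have "(\<integral>\<^sup>+x. H x \<partial>M) \<le> ennreal \<epsilon>"
      using H(2) n by (meson ennreal_leI less_imp_le order_trans)
    with H(1,3) close show ?thesis by blast
  qed
  with r show "\<exists>r>0. \<forall>u\<in>S. \<exists>H\<in>borel_measurable M. (\<integral>\<^sup>+x. H x \<partial>M) \<le> ennreal \<epsilon> \<and>
      (\<forall>x\<in>space M. \<forall>y\<in>space M. \<rho> x y < r \<longrightarrow> ennreal (\<bar>u x - u y\<bar> powr p) \<le> H x + H y)"
    by blast
qed

lemma (in dominated_quasi_metric_measure) compact_embedding_if_vanishing_oscillation: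
  assumes p: "p > 0" and x0: "x0 \<in> space M"
    and avg: "r0 > 0" "\<And>r. 0 < r \<Longrightarrow> r \<le> r0 \<Longrightarrow> uniformly_integrable_averaging r"
      "\<And>r. 0 < r \<Longrightarrow> r \<le> r0 \<Longrightarrow> tight_averaging x0 r"
    and V: "V \<subseteq> Lp_space M p" and norm: "\<And>u. Lp_fun_norm M p u \<le> norm_V u"
    and osc: "\<And>S K. S \<subseteq> V \<Longrightarrow> K \<ge> 0 \<Longrightarrow> (\<And>u. u \<in> S \<Longrightarrow> norm_V u \<le> ennreal K) \<Longrightarrow>
      vanishing_oscillation p S"
  shows "compact_embedding M V norm_V N (Lp_space N p) (Lp_fun_norm N p)"
  unfolding compact_embedding_def
proof (intro conjI ballI impI allI)
  show "V \<subseteq> Lp_space N p"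
  proof
    fix u assume "u \<in> V"
    then have u: "u \<in> borel_measurable M" "(\<integral>\<^sup>+x. ennreal (\<bar>u x\<bar> powr p) \<partial>M) < \<infinity>"
      using V Lp_fun_norm_less_top_iff[OF p, of M u] by (auto simp: Lp_space_def)
    have "(\<integral>\<^sup>+x. ennreal (\<bar>u x\<bar> powr p) \<partial>N) \<le> ennreal C * (\<integral>\<^sup>+x. ennreal (\<bar>u x\<bar> powr p) \<partial>M)"
      by (rule nn_integral_le_dominated[OF sets_N dominated])
    also have "\<dots> < \<infinity>"
      using u(2) by (simp add: ennreal_mult_less_top)
    finally show "u \<in> Lp_space N p"
      using u(1) Lp_fun_norm_less_top_iff[OF p, of N u] by (simp add: Lp_space_def measurable_N)
  qed
next
  fix u v :: "'a \<Rightarrow> real" assume "AE x in M. u x = v x"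
  then obtain E where "E \<in> null_sets M" "{x\<in>space M. u x \<noteq> v x} \<subseteq> E"
    by (auto simp: eventually_ae_filter)
  moreover have "E \<in> null_sets N"
    using dominated[of E] \<open>E \<in> null_sets M\<close> by (auto simp: null_sets_def sets_N)
  ultimately show "AE x in N. u x = v x"
    by (auto simp: eventually_ae_filter space_N)
next
  fix S assume S: "S \<subseteq> V" and "norm_bounded norm_V S"
  then obtain K where "\<And>u. u \<in> S \<Longrightarrow> norm_V u \<le> ennreal K"
    by (auto simp: norm_bounded_def)
  then have K: "max 0 K \<ge> 0" "\<And>u. u \<in> S \<Longrightarrow> norm_V u \<le> ennreal (max 0 K)"
    by (simp, meson ennreal_leI max.cobounded2 order_trans)
  have "(\<integral>\<^sup>+x. ennreal (\<bar>u x\<bar> powr p) \<partial>M) \<le> ennreal (max 0 K powr p)" if "u \<in> S" for u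
    using order_trans[OF norm K(2)[OF that]] by (intro Lp_fun_norm_leD p K(1))
  moreover have "S \<subseteq> borel_measurable M"
    using S V by (auto simp: Lp_space_def)
  ultimately show "norm_totally_bounded (Lp_fun_norm N p) S"
    using osc[OF S K]
    by (intro norm_totally_bounded_if_vanishing_oscillation[OF p _ x0 _ _ _ avg, where K = "max 0 K powr p"])
      auto
qed

section \<open>The compact embeddings\<close>

lemma exists_ge_1_triangle_constant:
  assumes "quasi_metric_on X \<rho>"
  shows "\<exists>c\<ge>1. \<forall>x\<in>X. \<forall>y\<in>X. \<forall>z\<in>X. \<rho> x y \<le> c * max (\<rho> x z) (\<rho> z y)"
proof -
  obtain c where c: "\<And>x y z. x \<in> X \<Longrightarrow> y \<in> X \<Longrightarrow> z \<in> X \<Longrightarrow> \<rho> x y \<le> c * max (\<rho> x z) (\<rho> z y)"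
    using assms unfolding quasi_metric_on_def by blast
  have nonneg: "0 \<le> \<rho> x y" if "x \<in> X" "y \<in> X" for x y
    using assms that by (simp add: quasi_metric_on_def)
  have "\<rho> x y \<le> max 1 c * max (\<rho> x z) (\<rho> z y)" if "x \<in> X" "y \<in> X" "z \<in> X" for x y z
  proof -
    have "c * max (\<rho> x z) (\<rho> z y) \<le> max 1 c * max (\<rho> x z) (\<rho> z y)"
      using nonneg that by (intro mult_right_mono) (auto simp: le_max_iff_disj)
    with c[OF that] show ?thesis by linarith
  qed
  then show ?thesis by (intro exI[of _ "max 1 c"]) auto
qed

lemma equivalent_qball_subset:
  assumes "\<kappa> > 0" and eq: "\<And>x y. x \<in> X \<Longrightarrow> y \<in> X \<Longrightarrow> inverse \<kappa> * \<rho> x y \<le> d x y \<and> d x y \<le> \<kappa> * \<rho> x y"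
    and x: "x \<in> X"
  shows "qball X \<rho> x r \<subseteq> qball X d x (\<kappa> * r)" and "qball X d x (r / \<kappa>) \<subseteq> qball X \<rho> x r"
proof -
  show "qball X \<rho> x r \<subseteq> qball X d x (\<kappa> * r)"
  proof
    fix y assume y: "y \<in> qball X \<rho> x r"
    then have "\<kappa> * \<rho> x y < \<kappa> * r"
      using \<open>\<kappa> > 0\<close> by (simp add: qball_def)
    then show "y \<in> qball X d x (\<kappa> * r)"
      using y eq[of x y] x by (auto simp: qball_def)
  qed
  show "qball X d x (r / \<kappa>) \<subseteq> qball X \<rho> x r"
  proof
    fix y assume y: "y \<in> qball X d x (r / \<kappa>)"
    then have "inverse \<kappa> * \<rho> x y < r / \<kappa>"
      using eq[of x y] x by (auto simp: qball_def)
    then show "y \<in> qball X \<rho> x r"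
      using y \<open>\<kappa> > 0\<close> by (simp add: qball_def field_simps)
  qed
qed

text \<open>
  Continuity of \<open>\<rho>\<close> makes its balls open for the topology of \<open>d\<close>, hence measurable, and
  comparison with the balls of \<open>d\<close> gives their measures. Semicontinuity is transferred from
  \<open>d\<close>-balls to \<open>\<rho>\<close>-balls by the equivalence of the two quasi-metrics.
\<close>

lemma dominated_quasi_metric_measureI:
  assumes space: "quasi_metric_measure_space d \<mu>"
    and dom: "sets \<nu> = sets \<mu>" "C > 0" "\<And>A. A \<in> sets \<mu> \<Longrightarrow> emeasure \<nu> A \<le> ennreal C * emeasure \<mu> A"
    and \<rho>: "quasi_metric_on (space \<mu>) \<rho>" "symmetric_on (space \<mu>) \<rho>"
      "quasi_metrics_equivalent (space \<mu>) d \<rho>"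
    and cont: "continuous_map (prod_topology (qtopology (space \<mu>) d) (qtopology (space \<mu>) d))
           euclideanreal (\<lambda>(x, y). \<rho> x y)"
  shows "\<exists>c. dominated_quasi_metric_measure \<mu> \<nu> \<rho> c C"
proof -
  let ?X = "space \<mu>" and ?T = "qtopology (space \<mu>) d"
  obtain c where c: "c \<ge> 1"
    "\<And>x y z. x \<in> ?X \<Longrightarrow> y \<in> ?X \<Longrightarrow> z \<in> ?X \<Longrightarrow> \<rho> x y \<le> c * max (\<rho> x z) (\<rho> z y)"
    using exists_ge_1_triangle_constant[OF \<rho>(1)] by blast
  obtain \<kappa> where \<kappa>: "\<kappa> > 0"
    "\<And>x y. x \<in> ?X \<Longrightarrow> y \<in> ?X \<Longrightarrow> inverse \<kappa> * \<rho> x y \<le> d x y \<and> d x y \<le> \<kappa> * \<rho> x y"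
    using \<rho>(3) unfolding quasi_metrics_equivalent_def by blast
  have sub: "qball ?X \<rho> x r \<subseteq> qball ?X d x (\<kappa> * r)" "qball ?X d x (r / \<kappa>) \<subseteq> qball ?X \<rho> x r"
    if "x \<in> ?X" for x r
    using equivalent_qball_subset[of \<kappa> ?X \<rho> d x r] \<kappa> that by auto
  have d_ball: "qball ?X d x r \<in> sets \<mu>" "0 < emeasure \<mu> (qball ?X d x r)"
    "emeasure \<mu> (qball ?X d x r) < \<infinity>" if "x \<in> ?X" "r > 0" for x r
    using space that by (auto simp: quasi_metric_measure_space_def)
  have ball_sets: "qball ?X \<rho> x r \<in> sets \<mu>" if x: "x \<in> ?X" for x r
  proof -
    have "continuous_map ?T (prod_topology ?T ?T) (\<lambda>y. (x, y))"
      using x by (simp add: continuous_map_pairwise o_def topspace_qtopology)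
    then have "continuous_map ?T euclideanreal ((\<lambda>(x, y). \<rho> x y) \<circ> (\<lambda>y. (x, y)))"
      using cont by (rule continuous_map_compose)
    then have "openin ?T {y \<in> topspace ?T. \<rho> x y \<in> {..<r}}"
      by (intro openin_continuous_map_preimage[of _ euclideanreal]) (auto simp: o_def)
    then have "openin ?T (qball ?X \<rho> x r)"
      by (simp add: topspace_qtopology qball_def)
    then show ?thesis
      using space unfolding quasi_metric_measure_space_def by blast
  qed
  have usc: "\<exists>s>0. \<forall>x'\<in>qball ?X \<rho> x s. \<forall>y'\<in>qball ?X \<rho> y s. \<rho> x' y' < r"
    if xy: "x \<in> ?X" "y \<in> ?X" "\<rho> x y < r" for x y r
  proof -
    define W where "W = {a \<in> topspace (prod_topology ?T ?T). (\<lambda>(x, y). \<rho> x y) a \<in> {..<r}}"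
    have "openin (prod_topology ?T ?T) W"
      unfolding W_def using cont by (rule openin_continuous_map_preimage) auto
    moreover have "(x, y) \<in> W"
      using xy by (simp add: W_def topspace_qtopology)
    ultimately have "\<exists>U V. openin ?T U \<and> openin ?T V \<and> x \<in> U \<and> y \<in> V \<and> U \<times> V \<subseteq> W"
      by (simp add: openin_prod_topology_alt)
    then obtain U V where UV: "openin ?T U" "openin ?T V" "x \<in> U" "y \<in> V" "U \<times> V \<subseteq> W"
      by auto
    have "\<exists>s>0. qball ?X d x s \<subseteq> U" "\<exists>t>0. qball ?X d y t \<subseteq> V"
      using UV unfolding openin_qtopology by auto
    then obtain s t where st: "s > 0" "qball ?X d x s \<subseteq> U" "t > 0" "qball ?X d y t \<subseteq> V"
      by auto
    define a where "a = min s t / \<kappa>"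
    have a: "a > 0" "\<kappa> * a = min s t"
      using st \<kappa>(1) by (simp_all add: a_def)
    have "qball ?X d z (min s t) \<subseteq> qball ?X d z s" "qball ?X d z (min s t) \<subseteq> qball ?X d z t" for z
      by (auto simp: qball_def)
    then have "qball ?X \<rho> x a \<subseteq> U" "qball ?X \<rho> y a \<subseteq> V"
      using sub(1)[OF xy(1), of a] sub(1)[OF xy(2), of a] st(2,4) unfolding a(2)
      by (meson order_trans)+
    then have "(x', y') \<in> W" if "x' \<in> qball ?X \<rho> x a" "y' \<in> qball ?X \<rho> y a" for x' y'
      using UV(5) that by blast
    then have "\<rho> x' y' < r" if "x' \<in> qball ?X \<rho> x a" "y' \<in> qball ?X \<rho> y a" for x' y'
      using that by (simp add: W_def)
    with a(1) show ?thesis by blast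
  qed
  have "dominated_quasi_metric_measure \<mu> \<nu> \<rho> c C"
  proof
    fix x r assume x: "x \<in> ?X" and r: "(r::real) > 0"
    have r': "r / \<kappa> > 0" "\<kappa> * r > 0" using r \<kappa>(1) by auto
    have "0 < emeasure \<mu> (qball ?X d x (r / \<kappa>))"
      by (rule d_ball(2)[OF x r'(1)])
    also have "\<dots> \<le> emeasure \<mu> (qball ?X \<rho> x r)"
      by (rule emeasure_mono[OF sub(2)[OF x] ball_sets[OF x]])
    finally show "0 < emeasure \<mu> (qball ?X \<rho> x r)" .
    have "emeasure \<mu> (qball ?X \<rho> x r) \<le> emeasure \<mu> (qball ?X d x (\<kappa> * r))"
      by (rule emeasure_mono[OF sub(1)[OF x] d_ball(1)[OF x r'(2)]])
    also have "\<dots> < \<infinity>"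
      by (rule d_ball(3)[OF x r'(2)])
    finally show "emeasure \<mu> (qball ?X \<rho> x r) < \<infinity>" .
  next
    show "\<rho> x x = 0" if "x \<in> ?X" for x
      using \<rho>(1) that by (simp add: quasi_metric_on_def)
    show "\<rho> x y = \<rho> y x" if "x \<in> ?X" "y \<in> ?X" for x y
      using \<rho>(2) that by (simp add: symmetric_on_def)
  qed (fact c ball_sets usc dom)+
  then show ?thesis ..
qed

context dominated_quasi_metric_measure
begin

lemma ennreal_averaging_kernel:
  assumes "x \<in> space M" "r > 0"
  shows "ennreal \<bar>indicator (B y r) x / measure M (B x r)\<bar> = indicator (B y r) x / emeasure M (B x r)"
proof -
  have "emeasure M (B x r) = ennreal (measure M (B x r))" "measure M (B x r) > 0"
    using ball_pos[OF assms] ball_finite[OF assms] by (auto simp: emeasure_eq_ennreal_measure)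
  then show ?thesis
    by (auto simp: divide_ennreal ennreal_1[symmetric] simp del: ennreal_1 split: split_indicator)
qed

lemma uniformly_integrable_averagingI:
  assumes r: "r > 0"
    and equi: "equi_integrable N ((\<lambda>y x. indicator (B y r) x / measure M (B x r)) ` space M)"
  shows "uniformly_integrable_averaging r"
  unfolding uniformly_integrable_averaging_def
proof (intro allI impI)
  fix \<epsilon> :: real assume "\<epsilon> > 0"
  let ?G = "(\<lambda>y x. indicator (B y r) x / measure M (B x r)) ` space M"
  obtain \<delta> where \<delta>: "\<delta> > 0" "\<And>A. A \<in> sets N \<Longrightarrow> emeasure N A < ennreal \<delta> \<Longrightarrow>
      (SUP f\<in>?G. \<integral>\<^sup>+x\<in>A. ennreal \<bar>f x\<bar> \<partial>N) < ennreal \<epsilon>"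
    using equi \<open>\<epsilon> > 0\<close> unfolding equi_integrable_def by meson
  have "averaging_mass r A y \<le> ennreal \<epsilon>"
    if A: "A \<in> sets M" "emeasure N A < ennreal \<delta>" and y: "y \<in> space M" for A y
  proof -
    have "averaging_mass r A y = (\<integral>\<^sup>+x\<in>A. ennreal \<bar>indicator (B y r) x / measure M (B x r)\<bar> \<partial>N)"
      unfolding averaging_mass_def
      by (intro nn_integral_cong arg_cong2[of _ _ _ _ "(*)"] ennreal_averaging_kernel[symmetric] r refl)
        (simp add: space_N)
    also have "\<dots> \<le> (SUP f\<in>?G. \<integral>\<^sup>+x\<in>A. ennreal \<bar>f x\<bar> \<partial>N)"
      using y by (intro SUP_upper2[OF imageI[OF y]]) simp
    also have "\<dots> < ennreal \<epsilon>"
      using A by (intro \<delta>(2)) (auto simp: sets_N)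
    finally show ?thesis by simp
  qed
  with \<delta>(1) show "\<exists>\<delta>>0. \<forall>A\<in>sets M. emeasure N A < ennreal \<delta> \<longrightarrow>
      (\<forall>y\<in>space M. averaging_mass r A y \<le> ennreal \<epsilon>)"
    by blast
qed

lemma tight_averagingI:
  assumes lim: "((\<lambda>R::real. SUP y\<in>space M - B x0 R. \<integral>\<^sup>+x\<in>B y r. 1 / emeasure M (B x r) \<partial>N) \<longlongrightarrow> 0) at_top"
  shows "tight_averaging x0 r"
  unfolding tight_averaging_def
proof (intro allI impI)
  fix \<epsilon> :: real assume "\<epsilon> > 0"
  then have "eventually (\<lambda>R. (SUP y\<in>space M - B x0 R. \<integral>\<^sup>+x\<in>B y r. 1 / emeasure M (B x r) \<partial>N) < ennreal \<epsilon>) at_top"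
    using lim by (intro order_tendstoD) auto
  then have "eventually (\<lambda>R. R > 0 \<and> (SUP y\<in>space M - B x0 R. \<integral>\<^sup>+x\<in>B y r. 1 / emeasure M (B x r) \<partial>N) < ennreal \<epsilon>) at_top"
    using eventually_gt_at_top by (rule eventually_conj[rotated])
  then obtain R :: real where R: "R > 0"
    "(SUP y\<in>space M - B x0 R. \<integral>\<^sup>+x\<in>B y r. 1 / emeasure M (B x r) \<partial>N) < ennreal \<epsilon>"
    using eventually_happens'[OF trivial_limit_at_top_linorder] by blast
  have "averaging_mass r (space M) y \<le> ennreal \<epsilon>" if y: "y \<in> space M - B x0 R" for y
  proof -
    have "averaging_mass r (space M) y = (\<integral>\<^sup>+x\<in>B y r. 1 / emeasure M (B x r) \<partial>N)"
      unfolding averaging_mass_def by (intro nn_integral_cong) (auto simp: space_N split: split_indicator)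
    also have "\<dots> \<le> (SUP y\<in>space M - B x0 R. \<integral>\<^sup>+x\<in>B y r. 1 / emeasure M (B x r) \<partial>N)"
      using y by (rule SUP_upper)
    finally show ?thesis using R(2) by simp
  qed
  with R(1) show "\<exists>R>0. \<forall>y\<in>space M - B x0 R. averaging_mass r (space M) y \<le> ennreal \<epsilon>"
    by blast
qed

end

theorem theorem6p2:
  fixes d \<rho> :: "'a \<Rightarrow> 'a \<Rightarrow> real"
    and \<mu> \<nu> :: "'a measure"
    and C r0 \<alpha> p :: real
    and q :: ennreal
    and x0 :: 'a
  assumes "quasi_metric_measure_space d \<mu>"
    and "sets \<nu> = sets \<mu>"
    and "C > 0" and "\<And>A. A \<in> sets \<mu> \<Longrightarrow> emeasure \<nu> A \<le> ennreal C * emeasure \<mu> A"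
    and "quasi_metric_on (space \<mu>) \<rho>"
    and "symmetric_on (space \<mu>) \<rho>"
    and "quasi_metrics_equivalent (space \<mu>) d \<rho>"
    and "continuous_map (prod_topology (qtopology (space \<mu>) d) (qtopology (space \<mu>) d))
           euclideanreal (\<lambda>(x, y). \<rho> x y)"
    and "r0 > 0" and "x0 \<in> space \<mu>"
    and "\<And>r. 0 < r \<Longrightarrow> r \<le> r0 \<Longrightarrow>
           equi_integrable \<nu>
             ((\<lambda>y x. indicator (qball (space \<mu>) \<rho> y r) x / measure \<mu> (qball (space \<mu>) \<rho> x r))
                ` space \<mu>)"
    and "\<And>r. 0 < r \<Longrightarrow> r \<le> r0 \<Longrightarrow>
           ((\<lambda>R::real. SUP y\<in>space \<mu> - qball (space \<mu>) \<rho> x0 R.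
               \<integral>\<^sup>+x\<in>qball (space \<mu>) \<rho> y r. 1 / emeasure \<mu> (qball (space \<mu>) \<rho> x r) \<partial>\<nu>)
             \<longlongrightarrow> 0) at_top"
    and "\<alpha> > 0" and "p > 0" and "q > 0"
  shows "compact_embedding \<mu> (HTL_space d \<mu> \<alpha> p q) (HTL_norm d \<mu> \<alpha> p q)
           \<nu> (Lp_space \<nu> p) (Lp_fun_norm \<nu> p) \<and>
         compact_embedding \<mu> (HB_space d \<mu> \<alpha> p q) (HB_norm d \<mu> \<alpha> p q)
           \<nu> (Lp_space \<nu> p) (Lp_fun_norm \<nu> p)"
proof -
  let ?X = "space \<mu>"
  obtain c where "dominated_quasi_metric_measure \<mu> \<nu> \<rho> c C"
    using dominated_quasi_metric_measureI[OF assms(1-8)] by blast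
  then interpret dominated_quasi_metric_measure \<mu> \<nu> \<rho> c C .
  have d: "quasi_metric_on ?X d"
    using assms(1) by (simp add: quasi_metric_measure_space_def)
  have unif: "uniformly_integrable_averaging r" and tight: "tight_averaging x0 r"
    if "0 < r" "r \<le> r0" for r
    using that by (auto intro!: uniformly_integrable_averagingI tight_averagingI assms(11,12))
  note embed = compact_embedding_if_vanishing_oscillation[OF \<open>p > 0\<close> \<open>x0 \<in> ?X\<close> \<open>r0 > 0\<close> unif tight]
  note osc = vanishing_oscillation_of_fractional_gradients[OF \<open>p > 0\<close> \<open>\<alpha> > 0\<close> _ d assms(7)]
  show ?thesis
  proof (intro conjI embed)
    fix S and K :: real
    assume K: "K \<ge> 0" "\<And>u. u \<in> S \<Longrightarrow> HTL_norm d \<mu> \<alpha> p q u \<le> ennreal K"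
    show "vanishing_oscillation p S"
      by (rule osc[of "(K + 1) powr p"])
        (simp, rule fractional_gradient_of_HTL_norm[OF \<open>p > 0\<close> \<open>q > 0\<close> K(1) K(2)])
  next
    fix S and K :: real
    assume K: "K \<ge> 0" "\<And>u. u \<in> S \<Longrightarrow> HB_norm d \<mu> \<alpha> p q u \<le> ennreal K"
    show "vanishing_oscillation p S"
      by (rule osc[of "(K + 1) powr p"])
        (simp, rule fractional_gradient_of_HB_norm[OF \<open>p > 0\<close> \<open>q > 0\<close> K(1) K(2)])
  qed (auto simp: HTL_space_def HB_space_def HTL_norm_def HB_norm_def)
qed

end
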